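(* Let $(\mathcal E_\pm,\mathcal A_\pm,\mathcal B_\pm)$ be the holomorphic Manin triples underlying a generalized Kähler structure. Then the corresponding matched pairs are related by the following gauge equivalences of Courant algebroids $$\begin{array}{ccc} (\overline{\mathcal E_-},\overline{\mathcal A_-},\overline{\mathcal B_-}) & \xleftarrow{\;e^{i(\omega_+-\omega_-)}\;} & (\mathcal E_+,\mathcal A_+,\mathcal B_+)\\ {\scriptstyle e^{-i(\omega_++\omega_-)}}\uparrow & & \uparrow{\scriptstyle e^{-i(\omega_++\omega_-)}}\\ (\overline{\mathcal E_+},\overline{\mathcal A_+},\overline{\mathcal B_+}) & \xleftarrow{\;e^{i(\omega_+-\omega_-)}\;} & (\mathcal E_-,\mathcal A_-,\mathcal B_-) \end{array}$$ where the vertical maps only intertwine Dirac structures of type $\mathcal A$, and the horizontal maps only intertwine Dirac structures of type $\mathcal B$. That is, writing $L_{\mathcal A_\pm},L_{\mathcal B_\pm}$ for the matched pairs of $\mathcal A_\pm,\mathcal B_\pm$, $$L_{\mathcal A_+}=e^{-i(\omega_++\omega_-)}L_{\mathcal A_-},\qquad \overline{L_{\mathcal B_-}}=e^{i(\omega_+-\omega_-)}L_{\mathcal B_+},$$ together with the complex conjugates of these identities.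
   Context: $M$ is a smooth manifold with closed real 3-form $H$. $\mathbb TM=TM\oplus T^*M$ has pairing $\langle X+\alpha,Y+\beta\rangle=\iota_X\beta+\iota_Y\alpha$ and bracket $[X+\alpha,Y+\beta]_H=[X,Y]+\mathcal L_X\beta-\iota_Yd\alpha+\iota_X\iota_YH$. A generalized complex structure is a complex structure on $\mathbb TM$ whose $+i$-eigenbundle is maximal isotropic and involutive. A generalized Kähler structure is a commuting pair $(\mathbb J_A,\mathbb J_B)$ with $\langle\mathbb J_A\cdot,\mathbb J_B\cdot\rangle$ positive definite; equivalently, a Riemannian metric $g$ and orthogonal complex structures $I_\pm$ with $\omega_\pm=gI_\pm$ and $d^c_+\omega_+=-d^c_-\omega_-=H$, $d^c_\pm=i(\bar\partial_\pm-\partial_\pm)$, via $$\mathbb J_A=\tfrac12\begin{pmatrix}I_++I_-&(I_+-I_-)g^{-1}\\ g(I_+-I_-)&-(I_+^*+I_-^* )\end{pmatrix},\quad \mathbb J_B=\tfrac12\begin{pmatrix}I_+-I_-&(I_++I_-)g^{-1}\\ g(I_++I_-)&-(I_+^*-I_-^* )\end{pmatrix}.$$ Bilinear forms are viewed as maps $TM\to T^*M$; $X_\pm=(M,I_\pm)$; $L_A,L_B$ are the $+i$-eigenbundles of $\mathbb J_A,\mathbb J_B$. For a 2-form $B$, $e^B(X+\alpha)=X+\alpha+B(X)$; it is an isomorphism from $(\mathbb T_{\mathbb C}M,[\cdot,\cdot]_{\mathcal H})$ to $(\mathbb T_{\mathbb C}M,[\cdot,\cdot]_{\mathcal H+dB})$.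 A closed form $\mathcal H\in\Omega^{2,1}(X)\oplus\Omega^{3,0}(X)$ on a complex manifold $X$ defines a holomorphic Courant algebroid $\mathcal E$ on $\mathbb T_{1,0}X=T_{1,0}X\oplus T_{1,0}^*X$ with $\overline D_X(Y+\beta)=\pi_{1,0}[X,Y+\beta]_{\mathcal H}$ for $X\in T_{0,1}X$ and bracket $\pi_{1,0}[\cdot,\cdot]_{\mathcal H}$ on holomorphic sections, $\pi_{1,0}:\mathbb T_{\mathbb C}X\to\mathbb T_{1,0}X$ the projection. The matched pair of $\mathcal E$ is the smooth complex Courant algebroid $(\mathbb T_{\mathbb C}X,[\cdot,\cdot]_{\mathcal H})$, and the matched pair of a holomorphic Dirac structure $\mathcal A\subset\mathbb T_{1,0}X$ is $L_{\mathcal A}=\mathcal A\oplus T_{0,1}X$. Let $\mathcal E_\pm$ be the holomorphic Courant algebroid on $X_\pm$ given by $\mathcal H_\pm=\mp2i\partial_\pm\omega_\pm$; the conjugates $\overline{\mathcal E_\pm}$ over $\overline{X_\pm}$ are given by $\overline{\mathcal H_\pm}$. The underlying holomorphic Manin triples are $\mathcal E_\pm=\mathcal A_\pm\oplus\mathcal B_\pm$ with $$\mathcal A_+=\mathbb T_{1,0}X_+\cap e^{-i\omega_+}(\overline{L_A}),\quad \mathcal B_+=\mathbb T_{1,0}X_+\cap e^{-i\omega_+}(\overline{L_B}),\quad \mathcal A_-=\mathbb T_{1,0}X_-\cap e^{i\omega_-}(\overline{L_A}),\quad \mathcal B_-=\mathbb T_{1,0}X_-\cap e^{i\omega_-}(L_B).$$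 *)

theory Defs
  imports "HOL-Analysis.Analysis" "HOL-Library.Function_Algebras"
begin

section \<open>Smooth manifolds\<close>

text \<open>
  \<open>Ck_on k S f\<close>: \<open>f\<close> is \<open>k\<close> times continuously differentiable on the open set \<open>S\<close>.
\<close>

primrec Ck_on :: "nat \<Rightarrow> 'e::euclidean_space set \<Rightarrow> ('e \<Rightarrow> 'f::euclidean_space) \<Rightarrow> bool" where
  "Ck_on 0 S f \<longleftrightarrow> continuous_on S f"
| "Ck_on (Suc k) S f \<longleftrightarrow>
     (\<forall>x\<in>S. f differentiable at x) \<and> (\<forall>v. Ck_on k S (\<lambda>x. frechet_derivative f (at x) v))"

definition smooth_on :: "'e::euclidean_space set \<Rightarrow> ('e \<Rightarrow> 'f::euclidean_space) \<Rightarrow> bool" where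
  "smooth_on S f \<longleftrightarrow> (\<forall>k. Ck_on k S f)"

type_synonym ('a, 'e) atlas = "('a set \<times> ('a \<Rightarrow> 'e)) set"

text \<open>
  The underlying space of the manifold is the type \<open>'a\<close> itself (Hausdorff and second countable
  by its type classes); \<open>M\<close> is a smooth atlas on it with values in a Euclidean space.
\<close>

definition smooth_manifold ::
    "('a::{t2_space,second_countable_topology}, 'e::euclidean_space) atlas \<Rightarrow> bool" where
  "smooth_manifold M \<longleftrightarrow>
     (\<Union>(U, \<phi>)\<in>M. U) = UNIV \<and>
     (\<forall>(U, \<phi>)\<in>M. open U \<and> open (\<phi> ` U) \<and> (\<exists>\<psi>. homeomorphism U (\<phi> ` U) \<phi> \<psi>)) \<and>
     (\<forall>(U, \<phi>)\<in>M. \<forall>(V, \<psi>)\<in>M. smooth_on (\<phi> ` (U \<inter> V)) (\<psi> \<circ> the_inv_into U \<phi>))"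

text \<open>
  All bundles are complexified: \<open>smooth_funs M\<close> is the algebra of complex-valued smooth functions,
  and real objects are those fixed by complex conjugation.
\<close>

type_synonym 'a cfun = "'a \<Rightarrow> complex"

definition smooth_funs ::
    "('a::{t2_space,second_countable_topology}, 'e::euclidean_space) atlas \<Rightarrow> 'a cfun set" where
  "smooth_funs M = {f. \<forall>(U, \<phi>)\<in>M. smooth_on (\<phi> ` U) (f \<circ> the_inv_into U \<phi>)}"


section \<open>Vector fields and tensors\<close>

text \<open>
  Module multiplication on vector fields and forms, which are both functions into \<open>'a cfun\<close>.
  Addition, subtraction and products of functions are pointwise.
\<close>

definition smul :: "'a cfun \<Rightarrow> ('b \<Rightarrow> 'a cfun) \<Rightarrow> 'b \<Rightarrow> 'a cfun" (infixr "\<odot>" 75) where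
  "f \<odot> F = (\<lambda>b. f * F b)"

definition cmul :: "complex \<Rightarrow> ('b \<Rightarrow> 'a cfun) \<Rightarrow> 'b \<Rightarrow> 'a cfun" (infixr "\<odot>\<^sub>C" 75) where
  "c \<odot>\<^sub>C F = (\<lambda>_. c) \<odot> F"

text \<open>
  Sections of the complexified tangent bundle are the complex-linear derivations of the algebra
  of smooth functions.  As a normalization they vanish on non-smooth arguments, so that equality
  of vector fields is equality of functions; forms and endomorphisms are normalized likewise.
\<close>

type_synonym 'a vfield = "'a cfun \<Rightarrow> 'a cfun"

definition vfields ::
    "('a::{t2_space,second_countable_topology}, 'e::euclidean_space) atlas \<Rightarrow> 'a vfield set" where
  "vfields M = {X.
     (\<forall>f\<in>smooth_funs M. X f \<in> smooth_funs M) \<and> (\<forall>f. f \<notin> smooth_funs M \<longrightarrow> X f = 0) \<and>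
     (\<forall>f\<in>smooth_funs M. \<forall>h\<in>smooth_funs M. X (f + h) = X f + X h \<and> X (f * h) = f * X h + h * X f) \<and>
     (\<forall>c. X (\<lambda>_. c) = 0)}"

definition lie_bracket :: "'a vfield \<Rightarrow> 'a vfield \<Rightarrow> 'a vfield" where
  "lie_bracket X Y = (\<lambda>f. X (Y f) - Y (X f))"

text \<open>
  A covariant tensor field of degree \<open>k\<close> is a function-multilinear map on vector fields, encoded as
  a function on lists of vector fields that is zero on lists of length other than \<open>k\<close>.
\<close>

type_synonym 'a tensor = "'a vfield list \<Rightarrow> 'a cfun"

definition tensors ::
    "('a::{t2_space,second_countable_topology}, 'e::euclidean_space) atlas \<Rightarrow> nat \<Rightarrow> 'a tensor set"
  where
  "tensors M k = {T.
     (\<forall>Xs. length Xs = k \<and> set Xs \<subseteq> vfields M \<longrightarrow> T Xs \<in> smooth_funs M) \<and>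
     (\<forall>Xs. \<not> (length Xs = k \<and> set Xs \<subseteq> vfields M) \<longrightarrow> T Xs = 0) \<and>
     (\<forall>Xs i X Y f. length Xs = k \<and> set Xs \<subseteq> vfields M \<and> i < k \<and>
         X \<in> vfields M \<and> Y \<in> vfields M \<and> f \<in> smooth_funs M \<longrightarrow>
         T (Xs[i := X + Y]) = T (Xs[i := X]) + T (Xs[i := Y]) \<and>
         T (Xs[i := f \<odot> X]) = f * T (Xs[i := X]))}"

definition forms ::
    "('a::{t2_space,second_countable_topology}, 'e::euclidean_space) atlas \<Rightarrow> nat \<Rightarrow> 'a tensor set"
  where
  "forms M k = {\<omega>\<in>tensors M k. \<forall>Xs i j. i < j \<and> j < length Xs \<and> Xs ! i = Xs ! j \<longrightarrow> \<omega> Xs = 0}"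

text \<open>\<open>contract X B\<close> is also the map \<open>X \<mapsto> B(X)\<close> associated with a bilinear form \<open>B\<close>.\<close>

definition contract :: "'a vfield \<Rightarrow> 'a tensor \<Rightarrow> 'a tensor" where
  "contract X \<omega> = (\<lambda>Xs. \<omega> (X # Xs))"

definition del_nth :: "nat \<Rightarrow> 'b list \<Rightarrow> 'b list" where
  "del_nth i xs = take i xs @ drop (Suc i) xs"

text \<open>Exterior derivative, by the Koszul formula (without factor \<open>1/(k+1)\<close>).\<close>

definition extd ::
    "('a::{t2_space,second_countable_topology}, 'e::euclidean_space) atlas \<Rightarrow> 'a tensor \<Rightarrow> 'a tensor"
  where
  "extd M \<omega> = (\<lambda>Xs. if set Xs \<subseteq> vfields M then
       (\<Sum>i<length Xs. (- 1) ^ i * (Xs ! i) (\<omega> (del_nth i Xs))) +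
       (\<Sum>j<length Xs. \<Sum>i<j. (- 1) ^ (i + j) *
          \<omega> (lie_bracket (Xs ! i) (Xs ! j) # del_nth i (del_nth j Xs)))
     else 0)"

definition lie_deriv ::
    "('a::{t2_space,second_countable_topology}, 'e::euclidean_space) atlas \<Rightarrow>
     'a vfield \<Rightarrow> 'a tensor \<Rightarrow> 'a tensor" where
  "lie_deriv M X \<omega> = (\<lambda>Xs. if set Xs \<subseteq> vfields M then
       X (\<omega> Xs) - (\<Sum>i<length Xs. \<omega> (Xs[i := lie_bracket X (Xs ! i)]))
     else 0)"

definition cnj_fun :: "'a cfun \<Rightarrow> 'a cfun" where
  "cnj_fun f = (\<lambda>p. cnj (f p))"

definition cnj_vf :: "'a vfield \<Rightarrow> 'a vfield" where
  "cnj_vf X = (\<lambda>f. cnj_fun (X (cnj_fun f)))"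

definition cnj_tensor :: "'a tensor \<Rightarrow> 'a tensor" where
  "cnj_tensor \<omega> = (\<lambda>Xs. cnj_fun (\<omega> (map cnj_vf Xs)))"


section \<open>The generalized tangent bundle\<close>

text \<open>Subbundles are represented by their modules of smooth sections.\<close>

type_synonym 'a gsection = "'a vfield \<times> 'a tensor"

definition gsections ::
    "('a::{t2_space,second_countable_topology}, 'e::euclidean_space) atlas \<Rightarrow> 'a gsection set" where
  "gsections M = vfields M \<times> forms M 1"

definition gsmul :: "'a cfun \<Rightarrow> 'a gsection \<Rightarrow> 'a gsection" where
  "gsmul f a = (f \<odot> fst a, f \<odot> snd a)"

definition cnj_sec :: "'a gsection \<Rightarrow> 'a gsection" where
  "cnj_sec a = (cnj_vf (fst a), cnj_tensor (snd a))"

definition pairing :: "'a gsection \<Rightarrow> 'a gsection \<Rightarrow> 'a cfun" where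
  "pairing a b = snd b [fst a] + snd a [fst b]"

definition dorfman ::
    "('a::{t2_space,second_countable_topology}, 'e::euclidean_space) atlas \<Rightarrow> 'a tensor \<Rightarrow>
     'a gsection \<Rightarrow> 'a gsection \<Rightarrow> 'a gsection" where
  "dorfman M H a b = (case (a, b) of ((X, \<alpha>), (Y, \<beta>)) \<Rightarrow>
     (lie_bracket X Y,
      lie_deriv M X \<beta> - contract Y (extd M \<alpha>) + contract X (contract Y H)))"

definition gauge_exp :: "'a tensor \<Rightarrow> 'a gsection \<Rightarrow> 'a gsection" where
  "gauge_exp B a = (fst a, snd a + contract (fst a) B)"

text \<open>
  \<open>F\<close> is an isomorphism, over the identity of \<open>M\<close>, from the Courant algebroid with twist \<open>H\<close>
  to the one with twist \<open>H'\<close>.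
\<close>

definition courant_iso ::
    "('a::{t2_space,second_countable_topology}, 'e::euclidean_space) atlas \<Rightarrow> 'a tensor \<Rightarrow> 'a tensor \<Rightarrow>
     ('a gsection \<Rightarrow> 'a gsection) \<Rightarrow> bool" where
  "courant_iso M H H' F \<longleftrightarrow>
     bij_betw F (gsections M) (gsections M) \<and>
     (\<forall>a\<in>gsections M. \<forall>b\<in>gsections M. \<forall>f\<in>smooth_funs M.
        F (a + b) = F a + F b \<and> F (gsmul f a) = gsmul f (F a) \<and>
        fst (F a) = fst a \<and>
        pairing (F a) (F b) = pairing a b \<and>
        F (dorfman M H a b) = dorfman M H' (F a) (F b))"


section \<open>Complex structures and types of forms\<close>

definition T10 ::
    "('a::{t2_space,second_countable_topology}, 'e::euclidean_space) atlas \<Rightarrow>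
     ('a vfield \<Rightarrow> 'a vfield) \<Rightarrow> 'a vfield set" where
  "T10 M I = {X\<in>vfields M. I X = \<i> \<odot>\<^sub>C X}"

definition T01 ::
    "('a::{t2_space,second_countable_topology}, 'e::euclidean_space) atlas \<Rightarrow>
     ('a vfield \<Rightarrow> 'a vfield) \<Rightarrow> 'a vfield set" where
  "T01 M I = {X\<in>vfields M. I X = (- \<i>) \<odot>\<^sub>C X}"

text \<open>The transpose \<open>I\<^sup>*\<close>; only used on 1-forms.\<close>

definition dual_map :: "('a vfield \<Rightarrow> 'a vfield) \<Rightarrow> 'a tensor \<Rightarrow> 'a tensor" where
  "dual_map I \<alpha> = (\<lambda>Xs. \<alpha> (map I Xs))"

text \<open>Integrability is stated in the Frobenius form of the Newlander--Nirenberg theorem.\<close>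

definition complex_structure ::
    "('a::{t2_space,second_countable_topology}, 'e::euclidean_space) atlas \<Rightarrow>
     ('a vfield \<Rightarrow> 'a vfield) \<Rightarrow> bool" where
  "complex_structure M I \<longleftrightarrow>
     (\<forall>X. X \<notin> vfields M \<longrightarrow> I X = 0) \<and>
     (\<forall>X\<in>vfields M. I X \<in> vfields M \<and> I (cnj_vf X) = cnj_vf (I X) \<and> I (I X) = - X) \<and>
     (\<forall>X\<in>vfields M. \<forall>Y\<in>vfields M. \<forall>f\<in>smooth_funs M. I (X + Y) = I X + I Y \<and> I (f \<odot> X) = f \<odot> I X) \<and>
     (\<forall>X\<in>T10 M I. \<forall>Y\<in>T10 M I. lie_bracket X Y \<in> T10 M I)"

definition proj10 :: "('a vfield \<Rightarrow> 'a vfield) \<Rightarrow> 'a vfield \<Rightarrow> 'a vfield" where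
  "proj10 I X = (1 / 2) \<odot>\<^sub>C (X - \<i> \<odot>\<^sub>C I X)"

definition proj01 :: "('a vfield \<Rightarrow> 'a vfield) \<Rightarrow> 'a vfield \<Rightarrow> 'a vfield" where
  "proj01 I X = (1 / 2) \<odot>\<^sub>C (X + \<i> \<odot>\<^sub>C I X)"

text \<open>The \<open>(p,q)\<close>-component of a form: \<open>S\<close> is the set of slots that receive a \<open>(1,0)\<close>-vector.\<close>

definition type_proj ::
    "('a vfield \<Rightarrow> 'a vfield) \<Rightarrow> nat \<Rightarrow> nat \<Rightarrow> 'a tensor \<Rightarrow> 'a tensor" where
  "type_proj I p q \<omega> = (\<lambda>Xs. if length Xs = p + q then
       (\<Sum>S | S \<subseteq> {..<p + q} \<and> card S = p.
          \<omega> (map (\<lambda>j. if j \<in> S then proj10 I (Xs ! j) else proj01 I (Xs ! j)) [0..<p + q]))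
     else 0)"

text \<open>\<open>del_op M I k\<close> and \<open>delbar_op M I k\<close> are \<open>\<partial>\<close> and \<open>\<partial>\<close>-bar on \<open>k\<close>-forms.\<close>

definition del_op ::
    "('a::{t2_space,second_countable_topology}, 'e::euclidean_space) atlas \<Rightarrow>
     ('a vfield \<Rightarrow> 'a vfield) \<Rightarrow> nat \<Rightarrow> 'a tensor \<Rightarrow> 'a tensor" where
  "del_op M I k \<omega> = (\<Sum>p\<le>k. type_proj I (Suc p) (k - p) (extd M (type_proj I p (k - p) \<omega>)))"

definition delbar_op ::
    "('a::{t2_space,second_countable_topology}, 'e::euclidean_space) atlas \<Rightarrow>
     ('a vfield \<Rightarrow> 'a vfield) \<Rightarrow> nat \<Rightarrow> 'a tensor \<Rightarrow> 'a tensor" where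
  "delbar_op M I k \<omega> = (\<Sum>p\<le>k. type_proj I p (Suc (k - p)) (extd M (type_proj I p (k - p) \<omega>)))"

definition dc_op ::
    "('a::{t2_space,second_countable_topology}, 'e::euclidean_space) atlas \<Rightarrow>
     ('a vfield \<Rightarrow> 'a vfield) \<Rightarrow> nat \<Rightarrow> 'a tensor \<Rightarrow> 'a tensor" where
  "dc_op M I k \<omega> = \<i> \<odot>\<^sub>C (delbar_op M I k \<omega> - del_op M I k \<omega>)"


section \<open>Generalized Kaehler structures\<close>

text \<open>
  Real endomorphisms of the generalized tangent bundle are given by their complex-linear
  extensions; only their values on \<open>gsections M\<close> matter.
\<close>

definition eigenbundle ::
    "('a::{t2_space,second_countable_topology}, 'e::euclidean_space) atlas \<Rightarrow>
     ('a gsection \<Rightarrow> 'a gsection) \<Rightarrow> 'a gsection set" where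
  "eigenbundle M J = {a\<in>gsections M. J a = gsmul (\<lambda>_. \<i>) a}"

definition gsubmodule ::
    "('a::{t2_space,second_countable_topology}, 'e::euclidean_space) atlas \<Rightarrow> 'a gsection set \<Rightarrow> bool"
  where
  "gsubmodule M L \<longleftrightarrow> L \<subseteq> gsections M \<and> 0 \<in> L \<and>
     (\<forall>a\<in>L. \<forall>b\<in>L. a + b \<in> L) \<and> (\<forall>f\<in>smooth_funs M. \<forall>a\<in>L. gsmul f a \<in> L)"

definition isotropic :: "'a gsection set \<Rightarrow> bool" where
  "isotropic L \<longleftrightarrow> (\<forall>a\<in>L. \<forall>b\<in>L. pairing a b = 0)"

definition maximal_isotropic ::
    "('a::{t2_space,second_countable_topology}, 'e::euclidean_space) atlas \<Rightarrow> 'a gsection set \<Rightarrow> bool"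
  where
  "maximal_isotropic M L \<longleftrightarrow> gsubmodule M L \<and> isotropic L \<and>
     (\<forall>L'. gsubmodule M L' \<and> isotropic L' \<and> L \<subseteq> L' \<longrightarrow> L' = L)"

definition involutive ::
    "('a::{t2_space,second_countable_topology}, 'e::euclidean_space) atlas \<Rightarrow> 'a tensor \<Rightarrow>
     'a gsection set \<Rightarrow> bool" where
  "involutive M H L \<longleftrightarrow> (\<forall>a\<in>L. \<forall>b\<in>L. dorfman M H a b \<in> L)"

definition generalized_complex ::
    "('a::{t2_space,second_countable_topology}, 'e::euclidean_space) atlas \<Rightarrow> 'a tensor \<Rightarrow>
     ('a gsection \<Rightarrow> 'a gsection) \<Rightarrow> bool" where
  "generalized_complex M H J \<longleftrightarrow>
     (\<forall>a\<in>gsections M. J a \<in> gsections M \<and> J (cnj_sec a) = cnj_sec (J a) \<and> J (J a) = - a) \<and>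
     (\<forall>a\<in>gsections M. \<forall>b\<in>gsections M. \<forall>f\<in>smooth_funs M.
        J (a + b) = J a + J b \<and> J (gsmul f a) = gsmul f (J a)) \<and>
     maximal_isotropic M (eigenbundle M J) \<and> involutive M H (eigenbundle M J)"

definition vf_nonzero_at ::
    "('a::{t2_space,second_countable_topology}, 'e::euclidean_space) atlas \<Rightarrow> 'a vfield \<Rightarrow> 'a \<Rightarrow> bool"
  where
  "vf_nonzero_at M X p \<longleftrightarrow> (\<exists>f\<in>smooth_funs M. X f p \<noteq> 0)"

definition form_nonzero_at ::
    "('a::{t2_space,second_countable_topology}, 'e::euclidean_space) atlas \<Rightarrow> 'a tensor \<Rightarrow> 'a \<Rightarrow> bool"
  where
  "form_nonzero_at M \<alpha> p \<longleftrightarrow> (\<exists>Y\<in>vfields M. \<alpha> [Y] p \<noteq> 0)"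

definition generalized_kaehler ::
    "('a::{t2_space,second_countable_topology}, 'e::euclidean_space) atlas \<Rightarrow> 'a tensor \<Rightarrow>
     ('a gsection \<Rightarrow> 'a gsection) \<Rightarrow> ('a gsection \<Rightarrow> 'a gsection) \<Rightarrow> bool" where
  "generalized_kaehler M H JA JB \<longleftrightarrow>
     generalized_complex M H JA \<and> generalized_complex M H JB \<and>
     (\<forall>a\<in>gsections M. JA (JB a) = JB (JA a)) \<and>
     (\<forall>a\<in>gsections M. \<forall>p. cnj_sec a = a \<and> (vf_nonzero_at M (fst a) p \<or> form_nonzero_at M (snd a) p) \<longrightarrow>
        0 < Re (pairing (JA a) (JB a) p))"

definition riemannian_metric ::
    "('a::{t2_space,second_countable_topology}, 'e::euclidean_space) atlas \<Rightarrow> 'a tensor \<Rightarrow> bool" where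
  "riemannian_metric M g \<longleftrightarrow>
     g \<in> tensors M 2 \<and> cnj_tensor g = g \<and>
     (\<forall>X\<in>vfields M. \<forall>Y\<in>vfields M. g [X, Y] = g [Y, X]) \<and>
     (\<forall>X\<in>vfields M. \<forall>p. cnj_vf X = X \<and> vf_nonzero_at M X p \<longrightarrow> 0 < Re (g [X, X] p))"

text \<open>The 2-form \<open>\<omega> = gI\<close>, that is \<open>\<omega>(X, Y) = g(IX, Y)\<close>.\<close>

definition kaehler_form :: "'a tensor \<Rightarrow> ('a vfield \<Rightarrow> 'a vfield) \<Rightarrow> 'a tensor" where
  "kaehler_form g I = (\<lambda>Xs. case Xs of [X, Y] \<Rightarrow> g [I X, Y] | _ \<Rightarrow> 0)"

definition bihermitian ::
    "('a::{t2_space,second_countable_topology}, 'e::euclidean_space) atlas \<Rightarrow> 'a tensor \<Rightarrow> 'a tensor \<Rightarrow>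
     ('a vfield \<Rightarrow> 'a vfield) \<Rightarrow> ('a vfield \<Rightarrow> 'a vfield) \<Rightarrow> bool" where
  "bihermitian M H g Iplus Iminus \<longleftrightarrow>
     riemannian_metric M g \<and> complex_structure M Iplus \<and> complex_structure M Iminus \<and>
     (\<forall>X\<in>vfields M. \<forall>Y\<in>vfields M. g [Iplus X, Iplus Y] = g [X, Y] \<and> g [Iminus X, Iminus Y] = g [X, Y]) \<and>
     dc_op M Iplus 2 (kaehler_form g Iplus) = H \<and> - dc_op M Iminus 2 (kaehler_form g Iminus) = H"

text \<open>
  The inverse of \<open>X \<mapsto> g(X)\<close>, which for a Riemannian metric is a bijection from vector fields to
  1-forms.
\<close>

definition metric_inv ::
    "('a::{t2_space,second_countable_topology}, 'e::euclidean_space) atlas \<Rightarrow> 'a tensor \<Rightarrow>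
     'a tensor \<Rightarrow> 'a vfield" where
  "metric_inv M g = inv_into (vfields M) (\<lambda>X. contract X g)"

definition gualtieri_JA ::
    "('a::{t2_space,second_countable_topology}, 'e::euclidean_space) atlas \<Rightarrow> 'a tensor \<Rightarrow>
     ('a vfield \<Rightarrow> 'a vfield) \<Rightarrow> ('a vfield \<Rightarrow> 'a vfield) \<Rightarrow> 'a gsection \<Rightarrow> 'a gsection" where
  "gualtieri_JA M g Iplus Iminus a = (case a of (X, \<alpha>) \<Rightarrow> let Z = metric_inv M g \<alpha> in
     gsmul (\<lambda>_. 1 / 2)
       ((Iplus X + Iminus X) + (Iplus Z - Iminus Z),
        contract (Iplus X - Iminus X) g - (dual_map Iplus \<alpha> + dual_map Iminus \<alpha>)))"

definition gualtieri_JB ::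
    "('a::{t2_space,second_countable_topology}, 'e::euclidean_space) atlas \<Rightarrow> 'a tensor \<Rightarrow>
     ('a vfield \<Rightarrow> 'a vfield) \<Rightarrow> ('a vfield \<Rightarrow> 'a vfield) \<Rightarrow> 'a gsection \<Rightarrow> 'a gsection" where
  "gualtieri_JB M g Iplus Iminus a = (case a of (X, \<alpha>) \<Rightarrow> let Z = metric_inv M g \<alpha> in
     gsmul (\<lambda>_. 1 / 2)
       ((Iplus X - Iminus X) + (Iplus Z + Iminus Z),
        contract (Iplus X + Iminus X) g - (dual_map Iplus \<alpha> - dual_map Iminus \<alpha>)))"

text \<open>
  A generalized Kaehler structure \<open>(JA, JB)\<close> together with its bihermitian data \<open>(g, Iplus, Iminus)\<close>.
  By Gualtieri's theorem each of the two determines the other; both descriptions are recorded.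
\<close>

definition generalized_kaehler_data ::
    "('a::{t2_space,second_countable_topology}, 'e::euclidean_space) atlas \<Rightarrow> 'a tensor \<Rightarrow>
     ('a gsection \<Rightarrow> 'a gsection) \<Rightarrow> ('a gsection \<Rightarrow> 'a gsection) \<Rightarrow>
     'a tensor \<Rightarrow> ('a vfield \<Rightarrow> 'a vfield) \<Rightarrow> ('a vfield \<Rightarrow> 'a vfield) \<Rightarrow> bool" where
  "generalized_kaehler_data M H JA JB g Iplus Iminus \<longleftrightarrow>
     generalized_kaehler M H JA JB \<and> bihermitian M H g Iplus Iminus \<and>
     (\<forall>a\<in>gsections M. JA a = gualtieri_JA M g Iplus Iminus a \<and> JB a = gualtieri_JB M g Iplus Iminus a)"


section \<open>Holomorphic Manin triples and matched pairs\<close>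

definition holo_gtangent ::
    "('a::{t2_space,second_countable_topology}, 'e::euclidean_space) atlas \<Rightarrow>
     ('a vfield \<Rightarrow> 'a vfield) \<Rightarrow> 'a gsection set" where
  "holo_gtangent M I = T10 M I \<times> {\<alpha>\<in>forms M 1. dual_map I \<alpha> = \<i> \<odot>\<^sub>C \<alpha>}"

text \<open>
  The data of a holomorphic Manin triple: the complex structure of the base, the closed form of
  type \<open>(2,1)+(3,0)\<close> that defines the holomorphic Courant algebroid, and the two holomorphic Dirac
  structures as smooth subbundles of \<open>holo_gtangent M I\<close>.
\<close>

record 'a holo_triple =
  cstr :: "'a vfield \<Rightarrow> 'a vfield"
  twist :: "'a tensor"
  dirA :: "'a gsection set"
  dirB :: "'a gsection set"

definition cnj_triple :: "'a holo_triple \<Rightarrow> 'a holo_triple" where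
  "cnj_triple E = \<lparr> cstr = (\<lambda>X. - cstr E X), twist = cnj_tensor (twist E),
                    dirA = cnj_sec ` dirA E, dirB = cnj_sec ` dirB E \<rparr>"

text \<open>
  The matched pair of the Courant algebroid of \<open>E\<close> has all of \<open>gsections M\<close> as its sections and
  \<open>dorfman M (twist E)\<close> as its bracket; those of the Dirac structures are as follows.
\<close>

definition matched_dirac ::
    "('a::{t2_space,second_countable_topology}, 'e::euclidean_space) atlas \<Rightarrow>
     ('a vfield \<Rightarrow> 'a vfield) \<Rightarrow> 'a gsection set \<Rightarrow> 'a gsection set" where
  "matched_dirac M I A = {a + (Y, 0) |a Y. a \<in> A \<and> Y \<in> T01 M I}"

definition matchedA ::
    "('a::{t2_space,second_countable_topology}, 'e::euclidean_space) atlas \<Rightarrow>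
     'a holo_triple \<Rightarrow> 'a gsection set" where
  "matchedA M E = matched_dirac M (cstr E) (dirA E)"

definition matchedB ::
    "('a::{t2_space,second_countable_topology}, 'e::euclidean_space) atlas \<Rightarrow>
     'a holo_triple \<Rightarrow> 'a gsection set" where
  "matchedB M E = matched_dirac M (cstr E) (dirB E)"

definition manin_plus ::
    "('a::{t2_space,second_countable_topology}, 'e::euclidean_space) atlas \<Rightarrow>
     ('a gsection \<Rightarrow> 'a gsection) \<Rightarrow> ('a gsection \<Rightarrow> 'a gsection) \<Rightarrow>
     'a tensor \<Rightarrow> ('a vfield \<Rightarrow> 'a vfield) \<Rightarrow> 'a holo_triple" where
  "manin_plus M JA JB g Iplus = (let \<omega> = kaehler_form g Iplus in
     \<lparr> cstr = Iplus,
       twist = (- 2 * \<i>) \<odot>\<^sub>C del_op M Iplus 2 \<omega>,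
       dirA = holo_gtangent M Iplus \<inter> gauge_exp ((- \<i>) \<odot>\<^sub>C \<omega>) ` cnj_sec ` eigenbundle M JA,
       dirB = holo_gtangent M Iplus \<inter> gauge_exp ((- \<i>) \<odot>\<^sub>C \<omega>) ` cnj_sec ` eigenbundle M JB \<rparr>)"

definition manin_minus ::
    "('a::{t2_space,second_countable_topology}, 'e::euclidean_space) atlas \<Rightarrow>
     ('a gsection \<Rightarrow> 'a gsection) \<Rightarrow> ('a gsection \<Rightarrow> 'a gsection) \<Rightarrow>
     'a tensor \<Rightarrow> ('a vfield \<Rightarrow> 'a vfield) \<Rightarrow> 'a holo_triple" where
  "manin_minus M JA JB g Iminus = (let \<omega> = kaehler_form g Iminus in
     \<lparr> cstr = Iminus,
       twist = (2 * \<i>) \<odot>\<^sub>C del_op M Iminus 2 \<omega>,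
       dirA = holo_gtangent M Iminus \<inter> gauge_exp (\<i> \<odot>\<^sub>C \<omega>) ` cnj_sec ` eigenbundle M JA,
       dirB = holo_gtangent M Iminus \<inter> gauge_exp (\<i> \<odot>\<^sub>C \<omega>) ` eigenbundle M JB \<rparr>)"

end

theory Submission
  imports Defs
begin

text \<open>
  The endomorphisms \<open>JA\<close> and \<open>JB\<close> act on the graph of \<open>g\<close> as \<open>Iplus\<close> and on the graph of \<open>-g\<close> as
  \<open>Iminus\<close> and \<open>-Iminus\<close>.  Hence the gauge transformations by \<open>-i\<omega>\<^sub>+\<close> and \<open>i\<omega>\<^sub>-\<close> carry the graphs over
  \<open>T\<^sub>0\<^sub>,\<^sub>1\<close> inside the appropriate (conjugate) eigenbundles to \<open>T\<^sub>0\<^sub>,\<^sub>1\<close> itself.  An isotropic bundle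
  containing \<open>T\<^sub>0\<^sub>,\<^sub>1\<close> is the matched pair of its intersection with the holomorphic part, so each
  matched pair is such a gauge transform of an eigenbundle, and composing gauge transformations
  gives all identities of Dirac structures.  For the brackets, \<open>\<omega>\<^sub>\<plusminus>\<close> is of type \<open>(1,1)\<close>, so
  \<open>d = \<partial> + \<partial>\<close>-bar on it and the twists are \<open>H \<mp> i d\<omega>\<^sub>\<plusminus>\<close>, while \<open>e\<^sup>B\<close> shifts a twist by \<open>dB\<close>.
\<close>

section \<open>Smooth functions\<close>

lemma has_derivative_frechet:
  assumes "f differentiable at x"
  shows "(f has_derivative frechet_derivative f (at x)) (at x)"
  using assms by (simp add: frechet_derivative_works)

text \<open>A derivative at a point depends only on values nearby, and every point of the open set
  \<open>S\<close> has a neighbourhood on which \<open>f\<close> and \<open>g\<close> agree. So the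
  Frechet derivatives agree on \<open>S\<close>, and the induction continues with them.\<close>

lemma Ck_on_cong:
  assumes "open S" and "\<And>x. x \<in> S \<Longrightarrow> f x = g x" and "Ck_on k S f"
  shows "Ck_on k S g"
  using assms(2,3)
proof (induction k arbitrary: f g)
  case 0
  then show ?case using continuous_on_eq by (metis Ck_on.simps(1))
next
  case (Suc k)
  have D: "(g has_derivative frechet_derivative f (at x)) (at x)" if "x \<in> S" for x
    using has_derivative_transform_within_open[OF has_derivative_frechet assms(1) that] Suc.prems that
    by auto
  have eq: "frechet_derivative g (at x) = frechet_derivative f (at x)" if "x \<in> S" for x
    using D[OF that] frechet_derivative_at by metis
  have "Ck_on k S (\<lambda>x. frechet_derivative g (at x) v)" for v
    using Suc.IH[of "\<lambda>x. frechet_derivative f (at x) v" "\<lambda>x. frechet_derivative g (at x) v"]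
      Suc.prems eq by auto
  then show ?case using D by (auto simp: differentiable_def)
qed

text \<open>\<open>Ck_on\<close> refers to the chosen \<open>frechet_derivative\<close>; uniqueness
  of the derivative allows an explicit formula \<open>D\<close> in its place, which is how the
  closure properties below are proved.\<close>

lemma Ck_on_SucI:
  assumes "open S" and "\<And>x. x \<in> S \<Longrightarrow> (f has_derivative D x) (at x)"
    and "\<And>v. Ck_on k S (\<lambda>x. D x v)"
  shows "Ck_on (Suc k) S f"
proof -
  have eq: "frechet_derivative f (at x) = D x" if "x \<in> S" for x
    using assms(2)[OF that] frechet_derivative_at by metis
  have "Ck_on k S (\<lambda>x. frechet_derivative f (at x) v)" for v
    by (rule Ck_on_cong[OF assms(1) _ assms(3)[of v]]) (simp add: eq)
  then show ?thesis using assms(2) by (auto simp: differentiable_def)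
qed

lemma Ck_on_Suc_imp:
  "Ck_on (Suc k) S f \<Longrightarrow> Ck_on k S f"
proof (induction k arbitrary: f)
  case 0
  then show ?case
    by (auto intro!: continuous_at_imp_continuous_on differentiable_imp_continuous_within)
next
  case (Suc k)
  then show ?case by (metis Ck_on.simps(2))
qed

lemma Ck_on_const: "Ck_on k S (\<lambda>_. c)"
  by (induction k arbitrary: c) auto

text \<open>Applied to complex conjugation, which is real-linear and therefore commutes with
  differentiation.\<close>

lemma Ck_on_linear:
  assumes "open S" and "bounded_linear L"
  shows "Ck_on k S f \<Longrightarrow> Ck_on k S (\<lambda>x. L (f x))"
proof (induction k arbitrary: f)
  case 0
  then show ?case
    using bounded_linear.continuous_on[OF assms(2)] by auto
next
  case (Suc k)
  show ?case
    by (rule Ck_on_SucI[OF assms(1), where D = "\<lambda>x v. L (frechet_derivative f (at x) v)"])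
      (use Suc in \<open>auto intro!: bounded_linear.has_derivative[OF assms(2)] has_derivative_frechet\<close>)
qed

lemma Ck_on_add:
  assumes "open S"
  shows "Ck_on k S f \<Longrightarrow> Ck_on k S g \<Longrightarrow> Ck_on k S (\<lambda>x. f x + g x)"
proof (induction k arbitrary: f g)
  case 0
  then show ?case by (auto intro: continuous_on_add)
next
  case (Suc k)
  show ?case
    by (rule Ck_on_SucI[OF assms,
          where D = "\<lambda>x v. frechet_derivative f (at x) v + frechet_derivative g (at x) v"])
      (use Suc in \<open>auto intro!: has_derivative_add has_derivative_frechet\<close>)
qed

lemma Ck_on_mult:
  fixes f g :: "'e::euclidean_space \<Rightarrow> complex"
  assumes "open S"
  shows "Ck_on k S f \<Longrightarrow> Ck_on k S g \<Longrightarrow> Ck_on k S (\<lambda>x. f x * g x)"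
proof (induction k arbitrary: f g)
  case 0
  then show ?case by (auto intro: continuous_on_mult)
next
  case (Suc k)
  \<comment> \<open>The Leibniz rule keeps undifferentiated factors, so \<open>f\<close> and
    \<open>g\<close> themselves are needed at the lower order \<open>k\<close>.\<close>
  have "Ck_on k S f" "Ck_on k S g"
    using Suc.prems Ck_on_Suc_imp by blast+
  then show ?case
    by (intro Ck_on_SucI[OF assms, where
          D = "\<lambda>x v. f x * frechet_derivative g (at x) v + frechet_derivative f (at x) v * g x"])
      (use Suc in \<open>auto intro!: has_derivative_mult has_derivative_frechet Ck_on_add[OF assms]\<close>)
qed

section \<open>The algebra of smooth functions on a manifold\<close>

locale smooth_atlas =
  fixes M :: "('a::{t2_space,second_countable_topology}, 'e::euclidean_space) atlas"
  assumes smooth_manifold: "smooth_manifold M"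
begin

lemma chart_open: "(U, \<phi>) \<in> M \<Longrightarrow> open (\<phi> ` U)"
  using smooth_manifold unfolding smooth_manifold_def by auto

lemma smooth_const [simp]: "(\<lambda>_. c) \<in> smooth_funs M"
  by (auto simp: smooth_funs_def smooth_on_def Ck_on_const o_def)

lemma smooth_zero [simp]: "0 \<in> smooth_funs M"
  by (simp add: zero_fun_def)

lemma smooth_add [simp]: "f \<in> smooth_funs M \<Longrightarrow> h \<in> smooth_funs M \<Longrightarrow> f + h \<in> smooth_funs M"
  by (fastforce simp: smooth_funs_def smooth_on_def o_def intro: Ck_on_add dest: chart_open)

lemma smooth_mult [simp]: "f \<in> smooth_funs M \<Longrightarrow> h \<in> smooth_funs M \<Longrightarrow> f * h \<in> smooth_funs M"
  by (fastforce simp: smooth_funs_def smooth_on_def o_def intro: Ck_on_mult dest: chart_open)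

lemma smooth_cnj [simp]: "f \<in> smooth_funs M \<Longrightarrow> cnj_fun f \<in> smooth_funs M"
  by (fastforce simp: smooth_funs_def smooth_on_def o_def cnj_fun_def
      intro: Ck_on_linear[OF _ bounded_linear_cnj] dest: chart_open)

lemma smooth_uminus [simp]:
  assumes "f \<in> smooth_funs M" shows "- f \<in> smooth_funs M"
proof -
  have "- f = (\<lambda>_. - 1) * f" by (simp add: fun_eq_iff)
  then show ?thesis using assms smooth_mult smooth_const by metis
qed

lemma smooth_diff [simp]: "f \<in> smooth_funs M \<Longrightarrow> h \<in> smooth_funs M \<Longrightarrow> f - h \<in> smooth_funs M"
  using smooth_add[of f "- h"] by simp

end

section \<open>Complexified vector fields and tensors\<close>

lemma cmul_apply [simp]: "(c \<odot>\<^sub>C F) b p = c * F b p"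
  by (simp add: cmul_def smul_def)

lemma cmul_eval: "(c \<odot>\<^sub>C F) b = (\<lambda>_. c) * F b"
  by (simp add: cmul_def smul_def)

lemma smul_apply [simp]: "(f \<odot> F) b p = f p * F b p"
  by (simp add: smul_def)

lemma cmul_cmul [simp]: "a \<odot>\<^sub>C b \<odot>\<^sub>C F = (a * b) \<odot>\<^sub>C F"
  by (simp add: fun_eq_iff)

lemma cnj_fun_apply [simp]: "cnj_fun f p = cnj (f p)"
  by (simp add: cnj_fun_def)

lemma cnj_fun_cnj_fun [simp]: "cnj_fun (cnj_fun f) = f"
  by (simp add: fun_eq_iff)

lemma cnj_fun_add: "cnj_fun (f + h) = cnj_fun f + cnj_fun h"
  by (simp add: fun_eq_iff)

lemma cnj_fun_mult: "cnj_fun (f * h) = cnj_fun f * cnj_fun h"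
  by (simp add: fun_eq_iff)

lemma cnj_fun_diff: "cnj_fun (f - h) = cnj_fun f - cnj_fun h"
  by (simp add: fun_eq_iff)

lemma cnj_fun_zero [simp]: "cnj_fun 0 = 0"
  by (simp add: fun_eq_iff)

lemma cnj_fun_const [simp]: "cnj_fun (\<lambda>_. c) = (\<lambda>_. cnj c)"
  by (simp add: fun_eq_iff)

lemma cnj_fun_sum: "cnj_fun (\<Sum>i\<in>A. f i) = (\<Sum>i\<in>A. cnj_fun (f i))"
  using sum_comp_morphism[of cnj_fun f A, OF cnj_fun_zero cnj_fun_add] by (simp add: comp_def)

lemma cnj_fun_sign [simp]: "cnj_fun ((- 1) ^ i) = (- 1) ^ i"
  by (induction i) (auto simp: fun_eq_iff)

lemma cnj_vf_cnj_vf [simp]: "cnj_vf (cnj_vf X) = X"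
  by (simp add: cnj_vf_def)

lemma cnj_fun_cnj_vf: "cnj_fun (cnj_vf X f) = X (cnj_fun f)"
  by (simp add: cnj_vf_def)

lemma cnj_vf_add: "cnj_vf (X + Y) = cnj_vf X + cnj_vf Y"
  by (simp add: cnj_vf_def fun_eq_iff)

lemma cnj_vf_smul: "cnj_vf (f \<odot> X) = cnj_fun f \<odot> cnj_vf X"
  by (simp add: cnj_vf_def fun_eq_iff)

lemma cnj_vf_cmul: "cnj_vf (c \<odot>\<^sub>C X) = cnj c \<odot>\<^sub>C cnj_vf X"
  by (simp add: cnj_vf_def fun_eq_iff)

lemma cnj_vf_lie_bracket: "cnj_vf (lie_bracket X Y) = lie_bracket (cnj_vf X) (cnj_vf Y)"
  by (simp add: cnj_vf_def lie_bracket_def cnj_fun_diff fun_eq_iff)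

lemma cnj_tensor_cnj_tensor [simp]: "cnj_tensor (cnj_tensor T) = T"
  by (simp add: cnj_tensor_def o_def)

lemma cnj_tensor_add: "cnj_tensor (S + T) = cnj_tensor S + cnj_tensor T"
  by (simp add: cnj_tensor_def fun_eq_iff)

lemma cnj_tensor_cmul: "cnj_tensor (c \<odot>\<^sub>C T) = cnj c \<odot>\<^sub>C cnj_tensor T"
  by (simp add: cnj_tensor_def fun_eq_iff)

lemma cnj_tensor_contract: "cnj_tensor (contract X T) = contract (cnj_vf X) (cnj_tensor T)"
  by (simp add: cnj_tensor_def contract_def del: cnj_fun_apply)

context smooth_atlas
begin

lemma vfieldsI:
  assumes "\<And>f. f \<in> smooth_funs M \<Longrightarrow> X f \<in> smooth_funs M"
    and "\<And>f. f \<notin> smooth_funs M \<Longrightarrow> X f = 0"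
    and "\<And>f h. f \<in> smooth_funs M \<Longrightarrow> h \<in> smooth_funs M \<Longrightarrow> X (f + h) = X f + X h"
    and "\<And>f h. f \<in> smooth_funs M \<Longrightarrow> h \<in> smooth_funs M \<Longrightarrow> X (f * h) = f * X h + h * X f"
    and "\<And>c. X (\<lambda>_. c) = 0"
  shows "X \<in> vfields M"
  using assms unfolding vfields_def by blast

text \<open>Holds for every \<open>f\<close>: on a non-smooth argument the normalization gives 0,
  which is smooth.\<close>

lemma vf_smooth [simp]: "X \<in> vfields M \<Longrightarrow> X f \<in> smooth_funs M"
  using smooth_zero unfolding vfields_def by (cases "f \<in> smooth_funs M") force+

lemma vf_nonsmooth: "X \<in> vfields M \<Longrightarrow> f \<notin> smooth_funs M \<Longrightarrow> X f = 0"
  unfolding vfields_def by blast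

lemma vf_add:
  "X \<in> vfields M \<Longrightarrow> f \<in> smooth_funs M \<Longrightarrow> h \<in> smooth_funs M \<Longrightarrow> X (f + h) = X f + X h"
  unfolding vfields_def by blast

lemma vf_mult:
  "X \<in> vfields M \<Longrightarrow> f \<in> smooth_funs M \<Longrightarrow> h \<in> smooth_funs M \<Longrightarrow> X (f * h) = f * X h + h * X f"
  unfolding vfields_def by blast

lemma vf_const: "X \<in> vfields M \<Longrightarrow> X (\<lambda>_. c) = 0"
  unfolding vfields_def by blast

lemma vf_zero: "X \<in> vfields M \<Longrightarrow> X 0 = 0"
  using vf_const[of X 0] by (simp add: zero_fun_def)

text \<open>Complex homogeneity comes from the Leibniz rule, because a derivation kills
  constants.\<close>

lemma vf_cmult:
  "X \<in> vfields M \<Longrightarrow> f \<in> smooth_funs M \<Longrightarrow> X ((\<lambda>_. c) * f) = (\<lambda>_. c) * X f"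
  by (simp add: vf_mult vf_const fun_eq_iff)

lemma vf_uminus:
  assumes "X \<in> vfields M" "f \<in> smooth_funs M" shows "X (- f) = - X f"
proof -
  have "- f = (\<lambda>_. - 1) * f" by (simp add: fun_eq_iff)
  then have "X (- f) = (\<lambda>_. - 1) * X f" using assms vf_cmult by metis
  then show ?thesis by (simp add: fun_eq_iff)
qed

lemma vf_zero_mem [simp]: "0 \<in> vfields M"
  by (rule vfieldsI) auto

lemma vf_add_mem [simp]: "X \<in> vfields M \<Longrightarrow> Y \<in> vfields M \<Longrightarrow> X + Y \<in> vfields M"
  by (rule vfieldsI) (auto simp: vf_nonsmooth vf_add vf_mult vf_const algebra_simps)

lemma vf_smul_mem [simp]: "f \<in> smooth_funs M \<Longrightarrow> X \<in> vfields M \<Longrightarrow> f \<odot> X \<in> vfields M"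
  by (rule vfieldsI) (auto simp: smul_def vf_nonsmooth vf_add vf_mult vf_const algebra_simps)

lemma vf_cmul_mem [simp]: "X \<in> vfields M \<Longrightarrow> c \<odot>\<^sub>C X \<in> vfields M"
  by (simp add: cmul_def)

lemma vf_uminus_mem [simp]: "X \<in> vfields M \<Longrightarrow> - X \<in> vfields M"
  by (rule vfieldsI) (auto simp: vf_nonsmooth vf_add vf_mult vf_const algebra_simps)

lemma vf_diff_mem [simp]: "X \<in> vfields M \<Longrightarrow> Y \<in> vfields M \<Longrightarrow> X - Y \<in> vfields M"
  using vf_add_mem[of X "- Y"] by simp

lemma vf_cnj_mem:
  assumes "X \<in> vfields M" shows "cnj_vf X \<in> vfields M"
proof (rule vfieldsI)
  fix f assume "f \<notin> smooth_funs M"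
  \<comment> \<open>Conjugation is an involution that preserves smoothness, so it preserves
    non-smoothness as well and the normalization carries over.\<close>
  then have "cnj_fun f \<notin> smooth_funs M" using smooth_cnj by fastforce
  then show "cnj_vf X f = 0" using vf_nonsmooth[OF assms] by (simp add: cnj_vf_def)
qed (use assms in \<open>auto simp: cnj_vf_def cnj_fun_add cnj_fun_mult vf_add[OF assms]
      vf_mult[OF assms] vf_const[OF assms] simp del: cnj_fun_apply\<close>)

lemma vf_cnj_mem_iff [simp]: "cnj_vf X \<in> vfields M \<longleftrightarrow> X \<in> vfields M"
  using vf_cnj_mem cnj_vf_cnj_vf by metis

lemma lie_bracket_mem [simp]:
  assumes "X \<in> vfields M" "Y \<in> vfields M" shows "lie_bracket X Y \<in> vfields M"
  by (rule vfieldsI)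
    (use assms in \<open>auto simp: lie_bracket_def assms[THEN vf_nonsmooth] assms[THEN vf_add]
      assms[THEN vf_mult] assms[THEN vf_const] assms[THEN vf_zero] algebra_simps\<close>)

lemma lie_bracket_add_left:
  assumes "X \<in> vfields M" "X' \<in> vfields M" "Y \<in> vfields M"
  shows "lie_bracket (X + X') Y = lie_bracket X Y + lie_bracket X' Y"
proof
  fix f show "lie_bracket (X + X') Y f = (lie_bracket X Y + lie_bracket X' Y) f"
    using assms by (cases "f \<in> smooth_funs M") 
      (auto simp: lie_bracket_def assms[THEN vf_add] assms[THEN vf_nonsmooth] assms[THEN vf_zero])
qed

lemma lie_bracket_add_right:
  assumes "X \<in> vfields M" "X' \<in> vfields M" "Y \<in> vfields M"
  shows "lie_bracket Y (X + X') = lie_bracket Y X + lie_bracket Y X'"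
proof
  fix f show "lie_bracket Y (X + X') f = (lie_bracket Y X + lie_bracket Y X') f"
    using assms by (cases "f \<in> smooth_funs M") 
      (auto simp: lie_bracket_def assms[THEN vf_add] assms[THEN vf_nonsmooth] assms[THEN vf_zero])
qed

section \<open>Tensor fields and differential forms\<close>

lemma tensor_eq_zero:
  "T \<in> tensors M k \<Longrightarrow> \<not> (length Xs = k \<and> set Xs \<subseteq> vfields M) \<Longrightarrow> T Xs = 0"
  unfolding tensors_def by blast

lemma tensor_smooth [simp]:
  assumes "T \<in> tensors M k" shows "T Xs \<in> smooth_funs M"
proof (cases "length Xs = k \<and> set Xs \<subseteq> vfields M")
  case True
  then show ?thesis using assms unfolding tensors_def by blast
next
  case False
  then show ?thesis using tensor_eq_zero[OF assms False] by simp
qed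

lemma tensor_multilinear:
  assumes "T \<in> tensors M k" "length Xs = k" "set Xs \<subseteq> vfields M" "i < k" "X \<in> vfields M"
  shows "Y \<in> vfields M \<Longrightarrow> T (Xs[i := X + Y]) = T (Xs[i := X]) + T (Xs[i := Y])"
    and "f \<in> smooth_funs M \<Longrightarrow> T (Xs[i := f \<odot> X]) = f * T (Xs[i := X])"
  using assms unfolding tensors_def by blast+

lemma tensorsI:
  assumes "\<And>Xs. length Xs = k \<Longrightarrow> set Xs \<subseteq> vfields M \<Longrightarrow> T Xs \<in> smooth_funs M"
    and "\<And>Xs. \<not> (length Xs = k \<and> set Xs \<subseteq> vfields M) \<Longrightarrow> T Xs = 0"
    and "\<And>Xs i X Y. length Xs = k \<Longrightarrow> set Xs \<subseteq> vfields M \<Longrightarrow> i < k \<Longrightarrow> X \<in> vfields M \<Longrightarrow>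
         Y \<in> vfields M \<Longrightarrow> T (Xs[i := X + Y]) = T (Xs[i := X]) + T (Xs[i := Y])"
    and "\<And>Xs i X f. length Xs = k \<Longrightarrow> set Xs \<subseteq> vfields M \<Longrightarrow> i < k \<Longrightarrow> X \<in> vfields M \<Longrightarrow>
         f \<in> smooth_funs M \<Longrightarrow> T (Xs[i := f \<odot> X]) = f * T (Xs[i := X])"
  shows "T \<in> tensors M k"
  using assms unfolding tensors_def by blast

lemma tensor_add_mem [simp]:
  assumes "S \<in> tensors M k" "T \<in> tensors M k" shows "S + T \<in> tensors M k"
  by (rule tensorsI)
    (use assms in \<open>auto simp: assms[THEN tensor_eq_zero] assms[THEN tensor_multilinear(1)]
      assms[THEN tensor_multilinear(2)] algebra_simps\<close>)

lemma tensor_cmul_mem [simp]: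
  assumes "T \<in> tensors M k" shows "c \<odot>\<^sub>C T \<in> tensors M k"
  by (rule tensorsI)
    (use assms in \<open>auto simp: cmul_eval assms[THEN tensor_eq_zero] assms[THEN tensor_multilinear(1)]
      assms[THEN tensor_multilinear(2)] algebra_simps\<close>)

lemma contract_tensor_mem:
  assumes "T \<in> tensors M (Suc k)" "X \<in> vfields M"
  shows "contract X T \<in> tensors M k"
proof (rule tensorsI)
  fix Xs i Y Z and f :: "'a cfun"
  assume *: "length Xs = k" "set Xs \<subseteq> vfields M" "i < k" "Y \<in> vfields M"
  \<comment> \<open>\<open>X\<close> occupies slot 0 of \<open>T\<close>, so slot \<open>i\<close>
    of the contraction is slot \<open>Suc i\<close> of \<open>T\<close>.\<close>
  note ml = tensor_multilinear[OF assms(1), of "X # Xs" "Suc i" Y]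
  show "Z \<in> vfields M \<Longrightarrow>
      contract X T (Xs[i := Y + Z]) = contract X T (Xs[i := Y]) + contract X T (Xs[i := Z])"
    using ml(1)[of Z] * assms(2) by (simp add: contract_def)
  show "f \<in> smooth_funs M \<Longrightarrow> contract X T (Xs[i := f \<odot> Y]) = f * contract X T (Xs[i := Y])"
    using ml(2)[of f] * assms(2) by (simp add: contract_def)
qed (use assms in \<open>auto simp: contract_def tensor_eq_zero[OF assms(1)]\<close>)

text \<open>Arguments and value are both conjugated, so a scalar is conjugated twice and the result
  is linear over functions, not conjugate-linear.\<close>

lemma cnj_tensor_mem:
  assumes "T \<in> tensors M k" shows "cnj_tensor T \<in> tensors M k"
proof (rule tensorsI)
  fix Xs i X Y and f :: "'a cfun"
  assume *: "length Xs = k" "set Xs \<subseteq> vfields M" "i < k" "X \<in> vfields M"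
  then have **: "set (map cnj_vf Xs) \<subseteq> vfields M" by auto
  note ml = tensor_multilinear[OF assms, of "map cnj_vf Xs" i "cnj_vf X"]
  show "Y \<in> vfields M \<Longrightarrow>
      cnj_tensor T (Xs[i := X + Y]) = cnj_tensor T (Xs[i := X]) + cnj_tensor T (Xs[i := Y])"
    using ml(1)[of "cnj_vf Y"] * **
    by (simp add: cnj_tensor_def map_update cnj_vf_add cnj_fun_add)
  show "f \<in> smooth_funs M \<Longrightarrow> cnj_tensor T (Xs[i := f \<odot> X]) = f * cnj_tensor T (Xs[i := X])"
    using ml(2)[of "cnj_fun f"] * **
    by (simp add: cnj_tensor_def map_update cnj_vf_smul cnj_fun_mult)
next
  fix Xs assume "\<not> (length Xs = k \<and> set Xs \<subseteq> vfields M)"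
  then have "\<not> (length (map cnj_vf Xs) = k \<and> set (map cnj_vf Xs) \<subseteq> vfields M)" by auto
  then have "T (map cnj_vf Xs) = 0" by (rule tensor_eq_zero[OF assms])
  then show "cnj_tensor T Xs = 0" by (simp add: cnj_tensor_def)
qed (use assms in \<open>auto simp: cnj_tensor_def\<close>)

lemma forms_tensors: "\<omega> \<in> forms M k \<Longrightarrow> \<omega> \<in> tensors M k"
  by (simp add: forms_def)

lemma forms_alternating:
  "\<omega> \<in> forms M k \<Longrightarrow> i < j \<Longrightarrow> j < length Xs \<Longrightarrow> Xs ! i = Xs ! j \<Longrightarrow> \<omega> Xs = 0"
  unfolding forms_def by blast

text \<open>Alternation is vacuous in degree 1: a list with two different slots has the wrong
  length, where the tensor is 0 anyway. Both spellings of the degree occur in goals.\<close>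

lemma forms_1 [simp]: "forms M 1 = tensors M 1" "forms M (Suc 0) = tensors M (Suc 0)"
  by (auto simp: forms_def less_Suc_eq tensor_eq_zero nth_Cons')

lemma forms_add_mem [simp]: "\<omega> \<in> forms M k \<Longrightarrow> \<eta> \<in> forms M k \<Longrightarrow> \<omega> + \<eta> \<in> forms M k"
  by (auto simp: forms_def)

lemma forms_cmul_mem [simp]: "\<omega> \<in> forms M k \<Longrightarrow> c \<odot>\<^sub>C \<omega> \<in> forms M k"
  by (auto simp: forms_def cmul_eval)

lemma forms_diff_mem [simp]:
  assumes "\<omega> \<in> forms M k" "\<eta> \<in> forms M k" shows "\<omega> - \<eta> \<in> forms M k"
proof -
  have "\<omega> - \<eta> = \<omega> + (- 1) \<odot>\<^sub>C \<eta>" by (simp add: fun_eq_iff)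
  then show ?thesis using assms by (simp only: forms_add_mem forms_cmul_mem)
qed

lemma tensor1_add:
  assumes "\<alpha> \<in> tensors M 1" "X \<in> vfields M" "Y \<in> vfields M"
  shows "\<alpha> [X + Y] = \<alpha> [X] + \<alpha> [Y]"
  using tensor_multilinear(1)[OF assms(1), of "[X]" 0 X Y] assms by simp

lemma tensor1_cmul:
  assumes "\<alpha> \<in> tensors M 1" "X \<in> vfields M"
  shows "\<alpha> [c \<odot>\<^sub>C X] = (\<lambda>_. c) * \<alpha> [X]"
  using tensor_multilinear(2)[OF assms(1), of "[X]" 0 X "\<lambda>_. c"] assms by (simp add: cmul_def)

lemma tensor2_add:
  assumes "T \<in> tensors M 2" "X \<in> vfields M" "Y \<in> vfields M" "Z \<in> vfields M"
  shows "T [X + Y, Z] = T [X, Z] + T [Y, Z]" and "T [Z, X + Y] = T [Z, X] + T [Z, Y]"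
  using tensor_multilinear(1)[OF assms(1), of "[X, Z]" 0 X Y]
    tensor_multilinear(1)[OF assms(1), of "[Z, X]" 1 X Y] assms by simp_all

lemma tensor2_smul:
  assumes "T \<in> tensors M 2" "X \<in> vfields M" "Z \<in> vfields M" "f \<in> smooth_funs M"
  shows "T [f \<odot> X, Z] = f * T [X, Z]" and "T [Z, f \<odot> X] = f * T [Z, X]"
  using tensor_multilinear(2)[OF assms(1), of "[X, Z]" 0 X f]
    tensor_multilinear(2)[OF assms(1), of "[Z, X]" 1 X f] assms by simp_all

lemma tensor2_cmul:
  assumes "T \<in> tensors M 2" "X \<in> vfields M" "Z \<in> vfields M"
  shows "T [c \<odot>\<^sub>C X, Z] = (\<lambda>_. c) * T [X, Z]" and "T [Z, c \<odot>\<^sub>C X] = (\<lambda>_. c) * T [Z, X]"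
  unfolding cmul_def by (rule tensor2_smul[OF assms smooth_const])+

lemma vf_uminus_cmul: "- X = (- 1) \<odot>\<^sub>C X" for X :: "'a vfield"
  by (simp add: fun_eq_iff)

lemma tensor2_uminus:
  assumes "T \<in> tensors M 2" "X \<in> vfields M" "Z \<in> vfields M"
  shows "T [- X, Z] = - T [X, Z]" and "T [Z, - X] = - T [Z, X]"
  using assms by (simp_all add: vf_uminus_cmul tensor2_cmul) (simp_all add: fun_eq_iff)

lemma tensor2_not_vf:
  assumes "T \<in> tensors M 2" "X \<notin> vfields M \<or> Y \<notin> vfields M" shows "T [X, Y] = 0"
  using tensor_eq_zero[OF assms(1), of "[X, Y]"] assms(2) by auto

lemma tensor2_zero:
  assumes "T \<in> tensors M 2" shows "T [0, Y] = 0" and "T [Y, 0] = 0"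
proof -
  have "T [0, Y] = 0 \<and> T [Y, 0] = 0" if "Y \<in> vfields M"
    using tensor2_add[OF assms, of 0 0 Y] that by (simp only: add_0_left vf_zero_mem simp_thms add_0_iff) simp
  then show "T [0, Y] = 0" and "T [Y, 0] = 0"
    using tensor2_not_vf[OF assms] by blast+
qed

text \<open>Polarization of \<open>B [X + Y, X + Y] = 0\<close>. Outside \<open>vfields M\<close>
  both sides are 0, so the identity can be used for arbitrary arguments.\<close>

lemma form2_antisym:
  assumes "B \<in> forms M 2" shows "B [X, Y] = - B [Y, X]"
proof (cases "X \<in> vfields M \<and> Y \<in> vfields M")
  case True
  have alt: "B [Z, Z] = 0" for Z
    by (rule forms_alternating[OF assms, of 0 1]) auto
  have "B [X + Y, X + Y] = B [X, X] + B [X, Y] + (B [Y, X] + B [Y, Y])"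
    using True by (simp add: tensor2_add[OF forms_tensors[OF assms]])
  then show ?thesis by (simp add: alt eq_neg_iff_add_eq_0)
next
  case False
  then show ?thesis using tensor2_not_vf[OF forms_tensors[OF assms]] by auto
qed

section \<open>The exterior derivative\<close>

lemma extd_not_vf: "\<not> set Xs \<subseteq> vfields M \<Longrightarrow> extd M \<omega> Xs = 0"
  by (simp add: extd_def)

lemma length_del_nth: "i < length xs \<Longrightarrow> length (del_nth i xs) = length xs - 1"
  by (auto simp: del_nth_def)

text \<open>The Koszul formula is defined for lists of any length. Each of its terms evaluates the
  form on a list shorter by one than \<open>Xs\<close>, so the normalization of the form passes to
  its derivative.\<close>

lemma extd_degree:
  assumes "\<omega> \<in> tensors M k" "length Xs \<noteq> Suc k"
  shows "extd M \<omega> Xs = 0"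
proof -
  have 1: "\<omega> (del_nth i Xs) = 0" if "i < length Xs" for i
    using that assms by (intro tensor_eq_zero[OF assms(1)]) (auto simp: length_del_nth)
  have 2: "\<omega> (Z # del_nth i (del_nth j Xs)) = 0" if "j < length Xs" "i < j" for i j Z
    using that assms by (intro tensor_eq_zero[OF assms(1)]) (auto simp: length_del_nth)
  have "(\<Sum>i<length Xs. (- 1) ^ i * (Xs ! i) (\<omega> (del_nth i Xs))) = 0" if "set Xs \<subseteq> vfields M"
  proof -
    have "(Xs ! i) 0 = 0" if "i < length Xs" for i
      using \<open>set Xs \<subseteq> vfields M\<close> that by (intro vf_zero) auto
    then show ?thesis by (intro sum.neutral) (auto simp: 1)
  qed
  then show ?thesis by (simp add: extd_def 2)
qed

lemma extd_tensor1:
  assumes "X \<in> vfields M" "Y \<in> vfields M"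
  shows "extd M \<alpha> [X, Y] = X (\<alpha> [Y]) - Y (\<alpha> [X]) - \<alpha> [lie_bracket X Y]"
  using assms by (simp add: extd_def del_nth_def numeral_2_eq_2)

lemma extd_tensor2:
  assumes "X \<in> vfields M" "Y \<in> vfields M" "Z \<in> vfields M"
  shows "extd M B [X, Y, Z] = X (B [Y, Z]) - Y (B [X, Z]) + Z (B [X, Y])
    - B [lie_bracket X Y, Z] + B [lie_bracket X Z, Y] - B [lie_bracket Y Z, X]"
  using assms by (simp add: extd_def del_nth_def numeral_2_eq_2)

text \<open>Being tensors makes the coefficient functions smooth, and vector fields are additive on
  smooth functions.\<close>

lemma extd_add:
  assumes "\<omega> \<in> tensors M k" "\<eta> \<in> tensors M k"
  shows "extd M (\<omega> + \<eta>) = extd M \<omega> + extd M \<eta>"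
proof
  fix Xs
  have "(\<Sum>i<length Xs. (- 1) ^ i * (Xs ! i) ((\<omega> + \<eta>) (del_nth i Xs))) =
      (\<Sum>i<length Xs. (- 1) ^ i * (Xs ! i) (\<omega> (del_nth i Xs))) +
      (\<Sum>i<length Xs. (- 1) ^ i * (Xs ! i) (\<eta> (del_nth i Xs)))" if "set Xs \<subseteq> vfields M"
    unfolding sum.distrib[symmetric]
    by (rule sum.cong) (use that assms nth_mem in \<open>fastforce simp: vf_add[of "Xs ! i" for i] algebra_simps\<close>)+
  then show "extd M (\<omega> + \<eta>) Xs = (extd M \<omega> + extd M \<eta>) Xs"
    by (simp add: extd_def sum.distrib algebra_simps)
qed

lemma extd_cmul:
  assumes "\<omega> \<in> tensors M k"
  shows "extd M (c \<odot>\<^sub>C \<omega>) = c \<odot>\<^sub>C extd M \<omega>"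
proof
  fix Xs
  have "(\<Sum>i<length Xs. (- 1) ^ i * (Xs ! i) ((c \<odot>\<^sub>C \<omega>) (del_nth i Xs))) =
      (\<lambda>_. c) * (\<Sum>i<length Xs. (- 1) ^ i * (Xs ! i) (\<omega> (del_nth i Xs)))" if "set Xs \<subseteq> vfields M"
    unfolding sum_distrib_left
    by (rule sum.cong)
      (use that assms nth_mem in \<open>fastforce simp: cmul_def smul_def vf_cmult[of "Xs ! i" for i] algebra_simps\<close>)+
  then show "extd M (c \<odot>\<^sub>C \<omega>) Xs = (c \<odot>\<^sub>C extd M \<omega>) Xs"
    by (simp add: extd_def cmul_def smul_def sum_distrib_left algebra_simps)
qed

text \<open>The exterior derivative is a real operator: conjugation is compatible with applying
  vector fields, with Lie brackets and with deleting slots. This gives the twists of the conjugate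
  triples.\<close>

lemma cnj_tensor_extd: "cnj_tensor (extd M \<omega>) = extd M (cnj_tensor \<omega>)"
proof
  fix Xs
  have map_del: "map cnj_vf (del_nth i Ys) = del_nth i (map cnj_vf Ys)" for i and Ys :: "'a vfield list"
    by (simp add: del_nth_def take_map drop_map)
  show "cnj_tensor (extd M \<omega>) Xs = extd M (cnj_tensor \<omega>) Xs"
  proof (cases "set Xs \<subseteq> vfields M")
    case True
    then have "set (map cnj_vf Xs) \<subseteq> vfields M" by auto
    with True show ?thesis
      unfolding cnj_tensor_def extd_def
      by (simp add: cnj_fun_add cnj_fun_sum cnj_fun_mult map_del cnj_vf_lie_bracket cnj_fun_cnj_vf
          del: cnj_fun_apply)
  next
    case False
    then have "\<not> set (map cnj_vf Xs) \<subseteq> vfields M" by auto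
    from extd_not_vf[OF this] extd_not_vf[OF False] show ?thesis
      by (simp only: cnj_tensor_def cnj_fun_zero)
  qed
qed

end

section \<open>Gauge transformations\<close>

lemma contract_add: "contract X (S + T) = contract X S + contract X T"
  by (simp add: contract_def fun_eq_iff)

lemma gauge_exp_gauge_exp: "gauge_exp B (gauge_exp C a) = gauge_exp (B + C) a"
  by (simp add: gauge_exp_def contract_add add_ac)

lemma gauge_exp_zero [simp]: "gauge_exp 0 a = a"
  by (simp add: gauge_exp_def contract_def fun_eq_iff prod_eq_iff)

lemma cnj_sec_cnj_sec [simp]: "cnj_sec (cnj_sec a) = a"
  by (simp add: cnj_sec_def)

lemma cnj_sec_gauge_exp: "cnj_sec (gauge_exp B a) = gauge_exp (cnj_tensor B) (cnj_sec a)"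
  by (simp add: cnj_sec_def gauge_exp_def cnj_tensor_add cnj_tensor_contract)

lemma cnj_sec_add: "cnj_sec (a + b) = cnj_sec a + cnj_sec b"
  by (simp add: cnj_sec_def cnj_vf_add cnj_tensor_add prod_eq_iff)

context smooth_atlas
begin

lemma contract_form2_mem [simp]:
  assumes "B \<in> forms M 2" "X \<in> vfields M" shows "contract X B \<in> tensors M (Suc 0)"
  using contract_tensor_mem[of B 1 X] forms_tensors[OF assms(1)] assms(2)
  by (simp add: numeral_2_eq_2)

lemma contract_vf_add:
  assumes "T \<in> tensors M 2" "X \<in> vfields M" "Y \<in> vfields M"
  shows "contract (X + Y) T = contract X T + contract Y T"
proof
  fix Zs
  show "contract (X + Y) T Zs = (contract X T + contract Y T) Zs"
  \<comment> \<open>Tensors are compared on all lists. Only lists of one vector field carry content;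
    on the others every term is 0 by normalization.\<close>
  proof (cases "length Zs = 1 \<and> set Zs \<subseteq> vfields M")
    case True
    then obtain Z where "Zs = [Z]" "Z \<in> vfields M" by (auto simp: length_Suc_conv)
    then show ?thesis using tensor2_add(1)[OF assms, of Z] by (simp add: contract_def)
  next
    case False
    then have "T (W # Zs) = 0" for W
      by (intro tensor_eq_zero[OF assms(1)]) auto
    then show ?thesis by (simp add: contract_def)
  qed
qed

lemma contract_vf_smul:
  assumes "T \<in> tensors M 2" "X \<in> vfields M" "f \<in> smooth_funs M"
  shows "contract (f \<odot> X) T = f \<odot> contract X T"
proof
  fix Zs
  show "contract (f \<odot> X) T Zs = (f \<odot> contract X T) Zs"
  proof (cases "length Zs = 1 \<and> set Zs \<subseteq> vfields M")
    case True
    then obtain Z where "Zs = [Z]" "Z \<in> vfields M" by (auto simp: length_Suc_conv)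
    then show ?thesis using tensor2_smul(1)[OF assms(1,2) _ assms(3), of Z]
      by (simp add: contract_def smul_def)
  next
    case False
    then have "T (W # Zs) = 0" for W
      by (intro tensor_eq_zero[OF assms(1)]) auto
    then show ?thesis by (simp add: contract_def smul_def)
  qed
qed

lemma lie_deriv_add:
  assumes "X \<in> vfields M" "\<omega> \<in> tensors M k" "\<eta> \<in> tensors M k"
  shows "lie_deriv M X (\<omega> + \<eta>) = lie_deriv M X \<omega> + lie_deriv M X \<eta>"
  using assms by (auto simp: fun_eq_iff lie_deriv_def vf_add[OF assms(1)] sum.distrib)

text \<open>By Cartan's formula and anticommutation of contractions, the left side is the commutator
  of the Lie derivative along \<open>X\<close> with contraction by \<open>Y\<close>, applied to
  \<open>B\<close>. It collects what \<open>B\<close> adds to the Dorfman bracket, which is why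
  \<open>e^B\<close> shifts the twist by \<open>dB\<close>. The proof compares Koszul formulas on
  one vector field.\<close>

lemma cartan_form2:
  assumes B: "B \<in> forms M 2" and X: "X \<in> vfields M" and Y: "Y \<in> vfields M"
  shows "lie_deriv M X (contract Y B) - contract Y (extd M (contract X B)) +
    contract X (contract Y (extd M B)) = contract (lie_bracket X Y) B" (is "?L = ?R")
proof
  fix Zs
  note B2 = forms_tensors[OF B]
  note XB = contract_form2_mem[OF B X] and YB = contract_form2_mem[OF B Y]
  show "?L Zs = ?R Zs"
  proof (cases "length Zs = 1 \<and> set Zs \<subseteq> vfields M")
    case True
    then obtain Z where Zs: "Zs = [Z]" and Z: "Z \<in> vfields M" by (auto simp: length_Suc_conv)
    \<comment> \<open>Antisymmetry puts the terms of \<open>extd M B [Y, X, Z]\<close> into the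
      order in which they occur in the other two summands, so that they cancel.\<close>
    have "Z (B [Y, X]) = - Z (B [X, Y])"
      using form2_antisym[OF B, of Y X] vf_uminus[OF Z, of "B [X, Y]"] B2 by simp
    moreover have "B [lie_bracket Y X, Z] = - B [lie_bracket X Y, Z]"
    proof -
      have "lie_bracket Y X = - lie_bracket X Y" by (simp add: lie_bracket_def fun_eq_iff)
      then show ?thesis using tensor2_uminus(1)[OF B2 lie_bracket_mem[OF X Y] Z] by simp
    qed
    moreover have "B [lie_bracket Y Z, X] = - B [X, lie_bracket Y Z]"
      "B [lie_bracket X Z, Y] = - B [Y, lie_bracket X Z]"
      by (rule form2_antisym[OF B])+
    ultimately show ?thesis
      using X Y Z
      by (simp add: Zs contract_def lie_deriv_def extd_tensor1 extd_tensor2 fun_eq_iff)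
  next
    case False
    have "contract Y B Zs = 0" "contract X B Zs = 0"
      using False by (auto intro!: tensor_eq_zero[OF YB] tensor_eq_zero[OF XB])
    have R: "?R Zs = 0"
      unfolding contract_def using False by (intro tensor_eq_zero[OF B2]) auto
    have 1: "contract Y (extd M (contract X B)) Zs = 0"
      unfolding contract_def[of Y] using False extd_degree[OF XB, of "Y # Zs"]
        extd_not_vf[of "Y # Zs"] by auto
    have 2: "contract X (contract Y (extd M B)) Zs = 0"
      unfolding contract_def[of Y] contract_def[of X]
      using False extd_degree[OF B2, of "Y # X # Zs"] extd_not_vf[of "Y # X # Zs"] by auto
    \<comment> \<open>The Lie derivative evaluates its form only on lists of the original length, so
      a wrong length leaves \<open>X 0\<close> and zero summands.\<close>
    have 3: "lie_deriv M X (contract Y B) Zs = 0"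
    proof (cases "set Zs \<subseteq> vfields M")
      case True
      then have "contract Y B Ws = 0" if "length Ws = length Zs" for Ws
        using False that by (intro tensor_eq_zero[OF YB]) auto
      then show ?thesis by (simp add: lie_deriv_def vf_zero[OF X])
    qed (simp add: lie_deriv_def)
    show ?thesis by (simp add: R 1 2 3)
  qed
qed

lemma gauge_exp_mem:
  assumes "B \<in> forms M 2" "a \<in> gsections M"
  shows "gauge_exp B a \<in> gsections M"
  using assms by (auto simp: gsections_def gauge_exp_def)

lemma gauge_exp_bij:
  assumes "B \<in> forms M 2"
  shows "bij_betw (gauge_exp B) (gsections M) (gsections M)"
proof (rule bij_betw_byWitness[where f' = "gauge_exp ((- 1) \<odot>\<^sub>C B)"])
  have "(- 1) \<odot>\<^sub>C B + B = 0" "B + (- 1) \<odot>\<^sub>C B = 0"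
    by (simp_all add: fun_eq_iff)
  then show "\<forall>a\<in>gsections M. gauge_exp ((- 1) \<odot>\<^sub>C B) (gauge_exp B a) = a"
    and "\<forall>a\<in>gsections M. gauge_exp B (gauge_exp ((- 1) \<odot>\<^sub>C B) a) = a"
    by (simp_all add: gauge_exp_gauge_exp)
qed (intro image_subsetI gauge_exp_mem forms_cmul_mem assms; assumption)+

lemma gauge_exp_add:
  assumes "B \<in> forms M 2" "a \<in> gsections M" "b \<in> gsections M"
  shows "gauge_exp B (a + b) = gauge_exp B a + gauge_exp B b"
  using assms by (auto simp: gauge_exp_def gsections_def contract_vf_add[OF forms_tensors[OF assms(1)]]
      add_ac)

lemma gauge_exp_gsmul:
  assumes "B \<in> forms M 2" "a \<in> gsections M" "f \<in> smooth_funs M"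
  shows "gauge_exp B (gsmul f a) = gsmul f (gauge_exp B a)"
proof -
  have "contract (f \<odot> fst a) B = f \<odot> contract (fst a) B"
    using assms by (intro contract_vf_smul forms_tensors) (auto simp: gsections_def)
  then show ?thesis
    by (simp add: gauge_exp_def gsmul_def fun_eq_iff distrib_left)
qed

text \<open>The extra terms are \<open>B [X, Y]\<close> and \<open>B [Y, X]\<close>, which cancel
  since \<open>B\<close> is skew.\<close>

lemma pairing_gauge_exp:
  assumes "B \<in> forms M 2"
  shows "pairing (gauge_exp B a) (gauge_exp B b) = pairing a b"
  using form2_antisym[OF assms, of "fst a" "fst b"]
  by (simp add: pairing_def gauge_exp_def contract_def)

text \<open>The twist \<open>H\<close> is arbitrary here, so the result serves for the complex
  twists of both triples and of their conjugates.\<close>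

lemma gauge_courant_iso:
  assumes B: "B \<in> forms M 2"
  shows "courant_iso M H (H + extd M B) (gauge_exp B)"
proof -
  have "gauge_exp B (dorfman M H a b) = dorfman M (H + extd M B) (gauge_exp B a) (gauge_exp B b)"
    if "a \<in> gsections M" "b \<in> gsections M" for a b
  proof -
    obtain X \<alpha> Y \<beta> where ab: "a = (X, \<alpha>)" "b = (Y, \<beta>)" by (cases a, cases b)
    then have m: "X \<in> vfields M" "Y \<in> vfields M" "\<alpha> \<in> tensors M 1" "\<beta> \<in> tensors M 1"
      using that by (auto simp: gsections_def)
    have "lie_deriv M X (\<beta> + contract Y B) = lie_deriv M X \<beta> + lie_deriv M X (contract Y B)"
      by (rule lie_deriv_add[OF m(1,4)]) (use B m in simp)
    moreover have "extd M (\<alpha> + contract X B) = extd M \<alpha> + extd M (contract X B)"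
      by (rule extd_add[OF m(3)]) (use B m in simp)
    ultimately show ?thesis
      \<comment> \<open>On the left \<open>e^B\<close> adds
        \<open>contract (lie_bracket X Y) B\<close> to the form part; on the right this is the sum
        of the new terms of the bracket.\<close>
      using cartan_form2[OF B m(1,2), symmetric]
      by (simp add: ab dorfman_def gauge_exp_def contract_add algebra_simps)
  qed
  then show ?thesis
    using gauge_exp_bij[OF B] gauge_exp_add[OF B] gauge_exp_gsmul[OF B] pairing_gauge_exp[OF B]
    unfolding courant_iso_def by (simp add: gauge_exp_def)
qed

end

section \<open>Complex structures and forms of type (1,1)\<close>

text \<open>Lists the candidate slot sets in the type components of a 3-form.\<close>

lemma Pow_3: "Pow {..<3::nat} = {{}, {0}, {1}, {2}, {0, 1}, {0, 2}, {1, 2}, {0, 1, 2}}"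
proof -
  have "{..<3::nat} = {0, 1, 2}" by auto
  then show ?thesis by (simp add: Pow_insert insert_commute)
qed

lemma cnj_vf_zero [simp]: "cnj_vf 0 = 0"
  by (simp add: cnj_vf_def fun_eq_iff)

lemma proj10_plus_proj01: "proj10 I X + proj01 I X = X"
  by (simp add: proj10_def proj01_def fun_eq_iff field_simps)

section \<open>Integrable complex structures and their eigenbundles\<close>

locale complex_atlas = smooth_atlas M
  for M :: "('a::{t2_space,second_countable_topology}, 'e::euclidean_space) atlas" +
  fixes I :: "'a vfield \<Rightarrow> 'a vfield"
  assumes complex_structure: "complex_structure M I"
begin

lemma I_not_vf: "X \<notin> vfields M \<Longrightarrow> I X = 0"
  using complex_structure unfolding complex_structure_def by blast

lemma I_mem [simp]: "X \<in> vfields M \<Longrightarrow> I X \<in> vfields M"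
  using complex_structure unfolding complex_structure_def by blast

lemma I_I: "X \<in> vfields M \<Longrightarrow> I (I X) = - X"
  using complex_structure unfolding complex_structure_def by blast

lemma I_add: "X \<in> vfields M \<Longrightarrow> Y \<in> vfields M \<Longrightarrow> I (X + Y) = I X + I Y"
  using complex_structure smooth_zero unfolding complex_structure_def by blast

lemma I_smul: "X \<in> vfields M \<Longrightarrow> f \<in> smooth_funs M \<Longrightarrow> I (f \<odot> X) = f \<odot> I X"
  using complex_structure unfolding complex_structure_def by blast

lemma I_cmul: "X \<in> vfields M \<Longrightarrow> I (c \<odot>\<^sub>C X) = c \<odot>\<^sub>C I X"
  by (simp add: cmul_def I_smul)

text \<open>Conjugation preserves both \<open>vfields M\<close> and its complement, and on the
  complement \<open>I\<close> is 0; hence no case distinction is left to later uses.\<close>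

lemma I_cnj: "I (cnj_vf X) = cnj_vf (I X)"
proof (cases "X \<in> vfields M")
  case True
  then show ?thesis using complex_structure unfolding complex_structure_def by blast
next
  case False
  then show ?thesis by (simp add: I_not_vf)
qed

lemma lie_bracket_T10:
  "X \<in> T10 M I \<Longrightarrow> Y \<in> T10 M I \<Longrightarrow> lie_bracket X Y \<in> T10 M I"
  using complex_structure unfolding complex_structure_def by blast

lemma T10_vf: "X \<in> T10 M I \<Longrightarrow> X \<in> vfields M"
  by (simp add: T10_def)

lemma T01_vf: "X \<in> T01 M I \<Longrightarrow> X \<in> vfields M"
  by (simp add: T01_def)

text \<open>Since \<open>I\<close> is real, conjugation swaps its eigenvalues.\<close>

lemma cnj_T01_iff: "cnj_vf X \<in> T10 M I \<longleftrightarrow> X \<in> T01 M I"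
proof -
  have "cnj_vf Y = cnj_vf Z \<longleftrightarrow> Y = Z" for Y Z :: "'a vfield"
    using cnj_vf_cnj_vf by metis
  then have "I (cnj_vf X) = \<i> \<odot>\<^sub>C cnj_vf X \<longleftrightarrow> I X = (- \<i>) \<odot>\<^sub>C X"
    using cnj_vf_cmul[of "- \<i>" X] I_cnj by simp metis
  then show ?thesis by (simp add: T10_def T01_def)
qed

lemma cnj_T10_iff: "cnj_vf X \<in> T01 M I \<longleftrightarrow> X \<in> T10 M I"
  using cnj_T01_iff[of "cnj_vf X"] by simp

lemma lie_bracket_T01:
  "X \<in> T01 M I \<Longrightarrow> Y \<in> T01 M I \<Longrightarrow> lie_bracket X Y \<in> T01 M I"
  using lie_bracket_T10[of "cnj_vf X" "cnj_vf Y"]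
  by (simp add: cnj_T01_iff cnj_vf_lie_bracket[symmetric])

lemma proj10_mem:
  assumes "X \<in> vfields M" shows "proj10 I X \<in> T10 M I"
proof -
  have "proj10 I X = (1 / 2) \<odot>\<^sub>C X + (- \<i> / 2) \<odot>\<^sub>C I X"
    by (simp add: proj10_def fun_eq_iff field_simps)
  then show ?thesis
    using assms by (simp add: T10_def I_add I_cmul I_I) (simp add: fun_eq_iff algebra_simps)
qed

lemma proj01_mem:
  assumes "X \<in> vfields M" shows "proj01 I X \<in> T01 M I"
proof -
  have "proj01 I X = (1 / 2) \<odot>\<^sub>C X + (\<i> / 2) \<odot>\<^sub>C I X"
    by (simp add: proj01_def fun_eq_iff field_simps)
  then show ?thesis
    using assms by (simp add: T01_def I_add I_cmul I_I) (simp add: fun_eq_iff algebra_simps)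
qed

text \<open>Outside \<open>vfields M\<close> both projections are half of \<open>X\<close>. So a
  form evaluated on the projections still vanishes by normalization, and type components can be
  compared on all lists.\<close>

lemma proj_not_vf:
  assumes "X \<notin> vfields M" shows "proj10 I X \<notin> vfields M" and "proj01 I X \<notin> vfields M"
proof -
  have "2 \<odot>\<^sub>C proj10 I X = X" "2 \<odot>\<^sub>C proj01 I X = X"
    using I_not_vf[OF assms] by (simp_all add: proj10_def proj01_def fun_eq_iff)
  then show "proj10 I X \<notin> vfields M" and "proj01 I X \<notin> vfields M"
    using assms vf_cmul_mem by metis+
qed

end

section \<open>Invariant 2-forms: type (1,1) and the splitting of d\<close>

locale invariant_form = complex_atlas M I
  for M :: "('a::{t2_space,second_countable_topology}, 'e::euclidean_space) atlas" and I +
  fixes B :: "'a tensor"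
  assumes B: "B \<in> forms M 2"
    and invariant: "X \<in> vfields M \<Longrightarrow> Y \<in> vfields M \<Longrightarrow> B [I X, I Y] = B [X, Y]"
begin

lemmas B2 = forms_tensors[OF B]

text \<open>On two eigenvectors for the same eigenvalue, \<open>i\<close> or \<open>-i\<close>,
  invariance multiplies the value by the square of that eigenvalue, which is -1.\<close>

lemma vanish_T10: "X \<in> T10 M I \<Longrightarrow> Y \<in> T10 M I \<Longrightarrow> B [X, Y] = 0"
proof -
  assume *: "X \<in> T10 M I" "Y \<in> T10 M I"
  then have "B [X, Y] = B [\<i> \<odot>\<^sub>C X, \<i> \<odot>\<^sub>C Y]"
    using invariant[of X Y] by (simp add: T10_def)
  also have "\<dots> = - B [X, Y]"
    using * by (simp add: T10_def tensor2_cmul[OF B2]) (simp add: fun_eq_iff)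
  finally show "B [X, Y] = 0" by (auto simp: fun_eq_iff)
qed

lemma vanish_T01: "X \<in> T01 M I \<Longrightarrow> Y \<in> T01 M I \<Longrightarrow> B [X, Y] = 0"
proof -
  assume *: "X \<in> T01 M I" "Y \<in> T01 M I"
  then have "B [X, Y] = B [(- \<i>) \<odot>\<^sub>C X, (- \<i>) \<odot>\<^sub>C Y]"
    using invariant[of X Y] by (simp add: T01_def)
  also have "\<dots> = - B [X, Y]"
    using * by (simp add: T01_def tensor2_cmul[OF B2]) (simp add: fun_eq_iff)
  finally show "B [X, Y] = 0" by (auto simp: fun_eq_iff)
qed

lemma B_split: "B [X, Y] = B [proj10 I X, proj01 I Y] + B [proj01 I X, proj10 I Y]"
proof (cases "X \<in> vfields M \<and> Y \<in> vfields M")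
  case True
  note m = proj10_mem[THEN T10_vf] proj01_mem[THEN T01_vf]
  have "B [X, Y] = B [proj10 I X + proj01 I X, proj10 I Y + proj01 I Y]"
    by (simp only: proj10_plus_proj01)
  also have "\<dots> = B [proj10 I X, proj10 I Y] + B [proj10 I X, proj01 I Y]
      + (B [proj01 I X, proj10 I Y] + B [proj01 I X, proj01 I Y])"
    using True by (simp add: tensor2_add[OF B2] m)
  finally show ?thesis
    using True vanish_T10[OF proj10_mem proj10_mem, of X Y] vanish_T01[OF proj01_mem proj01_mem, of X Y]
    by simp
next
  case False
  then show ?thesis
    using tensor2_not_vf[OF B2] proj_not_vf by (metis add_0)
qed

lemma type_11: "type_proj I (Suc 0) (Suc 0) B = B"
proof
  fix Xs
  have S: "{S. S \<subseteq> {..<2::nat} \<and> card S = 1} = {{0}, {1}}"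
    by (auto simp: card_1_singleton_iff)
  show "type_proj I (Suc 0) (Suc 0) B Xs = B Xs"
  proof (cases "length Xs = 2")
    case True
    then obtain X Y where "Xs = [X, Y]" by (auto simp: numeral_2_eq_2 length_Suc_conv)
    then show ?thesis
      using S B_split[of X Y] by (simp add: type_proj_def numeral_2_eq_2)
  qed (simp add: type_proj_def tensor_eq_zero[OF B2])
qed

lemma type_20: "type_proj I 2 0 B = 0"
proof
  fix Xs
  have S: "{S. S \<subseteq> {..<2::nat} \<and> card S = 2} = {{..<2}}"
    using card_subset_eq[of "{..<2::nat}"] by auto
  show "type_proj I 2 0 B Xs = 0 Xs"
  proof (cases "length Xs = 2")
    case True
    then obtain X Y where "Xs = [X, Y]" by (auto simp: numeral_2_eq_2 length_Suc_conv)
    moreover have "B [proj10 I X, proj10 I Y] = 0"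
      using vanish_T10[OF proj10_mem proj10_mem] tensor2_not_vf[OF B2] proj_not_vf by metis
    ultimately show ?thesis
      using S by (simp add: type_proj_def numeral_2_eq_2)
  qed (simp add: type_proj_def)
qed

lemma type_02: "type_proj I 0 2 B = 0"
proof
  fix Xs
  have S: "{S. S \<subseteq> {..<2::nat} \<and> card S = 0} = {{}}"
    by (auto simp: finite_subset card_eq_0_iff)
  show "type_proj I 0 2 B Xs = 0 Xs"
  proof (cases "length Xs = 2")
    case True
    then obtain X Y where "Xs = [X, Y]" by (auto simp: numeral_2_eq_2 length_Suc_conv)
    moreover have "B [proj01 I X, proj01 I Y] = 0"
      using vanish_T01[OF proj01_mem proj01_mem] tensor2_not_vf[OF B2] proj_not_vf by metis
    ultimately show ?thesis
      using S by (simp add: type_proj_def numeral_2_eq_2)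
  qed (simp add: type_proj_def)
qed

lemma extd_zero: "extd M (0 :: 'a tensor) = 0"
proof -
  have "0 \<odot>\<^sub>C B = 0" "0 \<odot>\<^sub>C extd M B = 0" by (simp_all add: fun_eq_iff)
  then show ?thesis using extd_cmul[OF B2, of 0] by simp
qed

lemma type_proj_zero: "type_proj I p q 0 = 0"
  by (simp add: type_proj_def fun_eq_iff)

text \<open>In the sum over the types of \<open>B\<close> only the (1,1)-component survives.\<close>

lemma del_eq: "del_op M I 2 B = type_proj I 2 1 (extd M B)"
  using type_11 type_20 type_02
  by (simp add: del_op_def numeral_2_eq_2 extd_zero type_proj_zero)

lemma delbar_eq: "delbar_op M I 2 B = type_proj I 1 2 (extd M B)"
  using type_11 type_20 type_02
  by (simp add: delbar_op_def numeral_2_eq_2 extd_zero type_proj_zero)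

text \<open>Allows every argument of \<open>dB\<close> to be split into its (1,0)- and
  (0,1)-parts.\<close>

lemma extd_slot_add:
  assumes "X \<in> vfields M" "X' \<in> vfields M" "Y \<in> vfields M" "Z \<in> vfields M"
  shows "extd M B [X + X', Y, Z] = extd M B [X, Y, Z] + extd M B [X', Y, Z]"
    and "extd M B [Y, X + X', Z] = extd M B [Y, X, Z] + extd M B [Y, X', Z]"
    and "extd M B [Y, Z, X + X'] = extd M B [Y, Z, X] + extd M B [Y, Z, X']"
  using assms
  by (simp_all add: extd_tensor2 tensor2_add[OF B2] lie_bracket_add_left lie_bracket_add_right
      vf_add[OF assms(1)] vf_add[OF assms(2)] vf_add[OF assms(3)] vf_add[OF assms(4)] tensor_smooth[OF B2]
      algebra_simps)

text \<open>Integrability enters here: the brackets in the Koszul formula stay of type (1,0), so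
  every term evaluates \<open>B\<close> on two fields of that type.\<close>

lemma extd_30:
  assumes "X \<in> T10 M I" "Y \<in> T10 M I" "Z \<in> T10 M I" shows "extd M B [X, Y, Z] = 0"
  using assms by (simp add: extd_tensor2 T10_vf vanish_T10 lie_bracket_T10
      assms[THEN T10_vf, THEN vf_zero])

lemma extd_03:
  assumes "X \<in> T01 M I" "Y \<in> T01 M I" "Z \<in> T01 M I" shows "extd M B [X, Y, Z] = 0"
  using assms by (simp add: extd_tensor2 T01_vf vanish_T01 lie_bracket_T01
      assms[THEN T01_vf, THEN vf_zero])

text \<open>Splitting three arguments gives eight terms. The two pure ones vanish, and the other six
  are the slot patterns of types (2,1) and (1,2).\<close>

lemma extd_eq_del_delbar: "extd M B = del_op M I 2 B + delbar_op M I 2 B"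
proof
  fix Xs
  let ?P = "proj10 I" and ?Q = "proj01 I" and ?d = "extd M B"
  have S2: "{S. S \<subseteq> {..<3::nat} \<and> card S = 2} = {{0, 1}, {0, 2}, {1, 2}}"
    and S1: "{S. S \<subseteq> {..<3::nat} \<and> card S = 1} = {{0}, {1}, {2}}"
    unfolding Pow_iff[symmetric] Pow_3 by auto
  show "extd M B Xs = (del_op M I 2 B + delbar_op M I 2 B) Xs"
  proof (cases "length Xs = 3")
    case True
    then obtain X Y Z where Xs: "Xs = [X, Y, Z]" by (auto simp: numeral_3_eq_3 length_Suc_conv)
    have "type_proj I 2 1 ?d Xs = ?d [?P X, ?P Y, ?Q Z] + ?d [?P X, ?Q Y, ?P Z] + ?d [?Q X, ?P Y, ?P Z]"
      using S2 by (simp add: type_proj_def Xs upt_rec doubleton_eq_iff)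
    moreover have "type_proj I 1 2 ?d Xs = ?d [?P X, ?Q Y, ?Q Z] + ?d [?Q X, ?P Y, ?Q Z] + ?d [?Q X, ?Q Y, ?P Z]"
      using S1[unfolded numeral_3_eq_3] by (simp add: type_proj_def Xs upt_rec)
    moreover have "?d [X, Y, Z] = ?d [?P X, ?P Y, ?Q Z] + ?d [?P X, ?Q Y, ?P Z] + ?d [?Q X, ?P Y, ?P Z]
        + (?d [?P X, ?Q Y, ?Q Z] + ?d [?Q X, ?P Y, ?Q Z] + ?d [?Q X, ?Q Y, ?P Z])"
    proof (cases "set [X, Y, Z] \<subseteq> vfields M")
      case True
      then have m: "?P X \<in> vfields M" "?P Y \<in> vfields M" "?P Z \<in> vfields M"
          "?Q X \<in> vfields M" "?Q Y \<in> vfields M" "?Q Z \<in> vfields M"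
        by (auto intro: proj10_mem[THEN T10_vf] proj01_mem[THEN T01_vf])
      have "?d [X, Y, Z] = ?d [?P X + ?Q X, ?P Y + ?Q Y, ?P Z + ?Q Z]"
        by (simp only: proj10_plus_proj01)
      also have "\<dots> = ?d [?P X, ?P Y, ?P Z] + ?d [?P X, ?P Y, ?Q Z]
          + (?d [?P X, ?Q Y, ?P Z] + ?d [?P X, ?Q Y, ?Q Z])
          + (?d [?Q X, ?P Y, ?P Z] + ?d [?Q X, ?P Y, ?Q Z]
          + (?d [?Q X, ?Q Y, ?P Z] + ?d [?Q X, ?Q Y, ?Q Z]))"
        using m by (simp add: extd_slot_add)
      finally show ?thesis
        using True by (simp add: extd_30 extd_03 proj10_mem proj01_mem add_ac)
    next
      case False
      \<comment> \<open>A projection of a non-field is again a non-field, so each of the terms has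
        an argument outside \<open>vfields M\<close>.\<close>
      then have "?d [U, V, W] = 0" if "U \<in> {X, ?P X, ?Q X}" "V \<in> {Y, ?P Y, ?Q Y}" "W \<in> {Z, ?P Z, ?Q Z}" for U V W
        using that proj_not_vf by (intro extd_not_vf) auto
      then show ?thesis by simp
    qed
    ultimately show ?thesis
      unfolding del_eq delbar_eq plus_fun_apply[of "type_proj _ _ _ _"] by (simp only: Xs)
  next
    case False
    then show ?thesis
      unfolding del_eq delbar_eq using extd_degree[OF B2, of Xs] by (simp add: type_proj_def)
  qed
qed

text \<open>The \<partial>-bar terms of \<open>d^c\<close> and of \<open>-i d\<close> cancel, which
  leaves \<open>-2 i\<close> times \<partial>; the second line is the negative. These are the twists
  of the plus and of the minus triple.\<close>

lemma dc_twist: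
  "(- 2 * \<i>) \<odot>\<^sub>C del_op M I 2 B = dc_op M I 2 B + extd M ((- \<i>) \<odot>\<^sub>C B)"
  "(2 * \<i>) \<odot>\<^sub>C del_op M I 2 B = - dc_op M I 2 B + extd M (\<i> \<odot>\<^sub>C B)"
  unfolding extd_cmul[OF B2] extd_eq_del_delbar dc_op_def
  by (simp_all add: fun_eq_iff algebra_simps)

end

section \<open>Matched pairs\<close>

context complex_atlas
begin

text \<open>A 1-form that kills \<open>T01 M I\<close> sees only the (1,0)-part of its argument, on
  which \<open>I\<close> is multiplication by \<open>i\<close>.\<close>

lemma holo_gtangentI:
  assumes "X \<in> T10 M I" "\<alpha> \<in> tensors M 1" "\<And>Y. Y \<in> T01 M I \<Longrightarrow> \<alpha> [Y] = 0"
  shows "(X, \<alpha>) \<in> holo_gtangent M I"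
proof -
  have "dual_map I \<alpha> Zs = (\<i> \<odot>\<^sub>C \<alpha>) Zs" for Zs
  proof (cases "length Zs = 1 \<and> set Zs \<subseteq> vfields M")
    case True
    then obtain Z where Zs: "Zs = [Z]" and Z: "Z \<in> vfields M" by (auto simp: length_Suc_conv)
    let ?P = "proj10 I Z" and ?Q = "proj01 I Z"
    have m: "?P \<in> vfields M" "?Q \<in> vfields M"
      using proj10_mem[OF Z] proj01_mem[OF Z] by (auto dest: T10_vf T01_vf)
    have e: "I ?P = \<i> \<odot>\<^sub>C ?P" "I ?Q = (- \<i>) \<odot>\<^sub>C ?Q"
      using proj10_mem[OF Z] proj01_mem[OF Z] by (auto simp: T10_def T01_def)
    have "I Z = I (?P + ?Q)" "\<alpha> [Z] = \<alpha> [?P + ?Q]"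
      by (simp_all only: proj10_plus_proj01)
    then have "\<alpha> [I Z] = (\<lambda>_. \<i>) * \<alpha> [?P] + (\<lambda>_. - \<i>) * \<alpha> [?Q]" "\<alpha> [Z] = \<alpha> [?P] + \<alpha> [?Q]"
      using m by (simp_all add: I_add e tensor1_add[OF assms(2)] tensor1_cmul[OF assms(2)])
    then show ?thesis
      using assms(3)[OF proj01_mem[OF Z]] by (simp add: Zs dual_map_def cmul_eval)
  next
    case False
    have "\<alpha> (map I Zs) = 0"
    proof (cases "length Zs = 1")
      case True
      then obtain Z where "Zs = [Z]" by (auto simp: length_Suc_conv)
      \<comment> \<open>For a non-field \<open>Z\<close>, \<open>I Z\<close> is the vector field 0,
        so the value comes from additivity and not from the normalization.\<close>
      moreover have "\<alpha> [0] = 0"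
        using tensor1_add[OF assms(2), of 0 0] by simp
      ultimately show ?thesis using False I_not_vf[of Z] by simp
    next
      case False
      then show ?thesis by (intro tensor_eq_zero[OF assms(2)]) simp
    qed
    then show ?thesis using tensor_eq_zero[OF assms(2) False] by (simp add: dual_map_def cmul_eval)
  qed
  then show ?thesis
    using assms by (simp add: holo_gtangent_def fun_eq_iff)
qed

text \<open>
  An isotropic \<open>L\<close> containing \<open>T\<^sub>0\<^sub>,\<^sub>1\<close> lies in the orthogonal complement of \<open>T\<^sub>0\<^sub>,\<^sub>1\<close>, which is
  \<open>T \<oplus> T\<^sup>*\<^sub>1\<^sub>,\<^sub>0\<close>.
\<close>

lemma matched_dirac_eq:
  assumes "L \<subseteq> gsections M" "isotropic L"
    and add: "\<And>a b. a \<in> L \<Longrightarrow> b \<in> L \<Longrightarrow> a + b \<in> L"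
    and T01: "\<And>X. X \<in> T01 M I \<Longrightarrow> (X, 0) \<in> L"
  shows "matched_dirac M I (holo_gtangent M I \<inter> L) = L"
proof
  show "matched_dirac M I (holo_gtangent M I \<inter> L) \<subseteq> L"
    unfolding matched_dirac_def using add[OF _ T01] by blast
  show "L \<subseteq> matched_dirac M I (holo_gtangent M I \<inter> L)"
  proof
    fix a assume a: "a \<in> L"
    obtain X \<alpha> where X\<alpha>: "a = (X, \<alpha>)" by (cases a)
    with a assms(1) have X: "X \<in> vfields M" and \<alpha>: "\<alpha> \<in> tensors M 1"
      by (auto simp: gsections_def)
    have Q: "proj01 I X \<in> T01 M I" by (rule proj01_mem[OF X])
    then have "- proj01 I X \<in> T01 M I"
      by (simp add: T01_def vf_uminus_cmul I_cmul mult.commute)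
    \<comment> \<open>As \<open>L\<close> contains \<open>T01 M I\<close>, the (0,1)-part of the
      vector component can be removed inside \<open>L\<close>.\<close>
    from add[OF a T01[OF this]] have "(X - proj01 I X, \<alpha>) \<in> L"
      by (simp add: X\<alpha>)
    moreover have "X - proj01 I X = proj10 I X"
      using proj10_plus_proj01[of I X] by (simp add: diff_eq_eq)
    moreover have "\<alpha> [Y] = 0" if "Y \<in> T01 M I" for Y
    proof -
      have "pairing a (Y, 0) = 0"
        using assms(2) a T01[OF that] by (simp add: isotropic_def)
      then show ?thesis by (simp add: pairing_def X\<alpha>)
    qed
    ultimately have "(proj10 I X, \<alpha>) \<in> holo_gtangent M I \<inter> L"
      using holo_gtangentI[OF proj10_mem[OF X] \<alpha>] by simp
    moreover have "a = (proj10 I X, \<alpha>) + (proj01 I X, 0)"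
      by (simp add: X\<alpha> proj10_plus_proj01)
    ultimately show "a \<in> matched_dirac M I (holo_gtangent M I \<inter> L)"
      using Q unfolding matched_dirac_def by blast
  qed
qed

text \<open>The (0,1)-fields of \<open>-I\<close> are the (1,0)-fields of \<open>I\<close>, that is
  the conjugates of \<open>T01 M I\<close>; so both summands of the matched pair are
  conjugated.\<close>

lemma cnj_matched_dirac:
  "matched_dirac M (\<lambda>X. - I X) (cnj_sec ` A) = cnj_sec ` matched_dirac M I A"
proof -
  have T: "T01 M (\<lambda>X. - I X) = cnj_vf ` T01 M I"
  proof -
    have "T01 M (\<lambda>X. - I X) = T10 M I"
      by (auto simp: T01_def T10_def fun_eq_iff)
    also have "\<dots> = cnj_vf ` T01 M I"
    proof
      show "T10 M I \<subseteq> cnj_vf ` T01 M I"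
        using cnj_T10_iff by (metis cnj_vf_cnj_vf image_iff subsetI)
      show "cnj_vf ` T01 M I \<subseteq> T10 M I"
        using cnj_T01_iff by auto
    qed
    finally show ?thesis .
  qed
  have cz: "(cnj_vf Y, 0) = cnj_sec (Y, 0)" for Y :: "'a vfield"
    by (simp add: cnj_sec_def cnj_tensor_def fun_eq_iff)
  \<comment> \<open>As a union of singletons, the matched pair lets the image under conjugation be
    pushed inside.\<close>
  have UN: "matched_dirac M J C = (\<Union>a\<in>C. \<Union>Y\<in>T01 M J. {a + (Y, 0)})" for J C
    unfolding matched_dirac_def by blast
  show ?thesis
    unfolding UN T by (simp add: image_UN cz cnj_sec_add)
qed

end

section \<open>Conjugate sections and nondegeneracy of the metric\<close>

context smooth_atlas
begin

lemma cnj_sec_mem: "a \<in> gsections M \<Longrightarrow> cnj_sec a \<in> gsections M"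
  by (auto simp: gsections_def cnj_sec_def cnj_tensor_mem)

lemma pairing_cnj_sec: "pairing (cnj_sec a) (cnj_sec b) = cnj_fun (pairing a b)"
  by (simp add: pairing_def cnj_sec_def cnj_tensor_def cnj_fun_add)

text \<open>
  Positivity is available only for real fields and only where they do not vanish, so degeneracy is
  tested globally, on the real and imaginary parts of the difference.
\<close>

lemma metric_injective:
  assumes g: "riemannian_metric M g"
  shows "inj_on (\<lambda>X. contract X g) (vfields M)"
proof (rule inj_onI)
  have g2: "g \<in> tensors M 2" and real: "cnj_tensor g = g"
    and pos: "\<And>X p. X \<in> vfields M \<Longrightarrow> cnj_vf X = X \<Longrightarrow> vf_nonzero_at M X p \<Longrightarrow> 0 < Re (g [X, X] p)"
    using g unfolding riemannian_metric_def by blast+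
  have zero: "X = 0" if X: "X \<in> vfields M" "cnj_vf X = X" "g [X, X] = 0" for X
  proof (intro ext)
    fix f p
    have "\<not> vf_nonzero_at M X p" using pos[OF X(1,2), of p] X(3) by auto
    then show "X f p = 0 f p"
      using vf_nonsmooth[OF X(1), of f] by (auto simp: vf_nonzero_at_def)
  qed
  fix X Y assume XY: "X \<in> vfields M" "Y \<in> vfields M" and eq: "contract X g = contract Y g"
  let ?D = "X - Y"
  let ?C = "cnj_vf ?D"
  let ?U = "?D + ?C" and ?V = "\<i> \<odot>\<^sub>C (?D - ?C)"
  have D: "?D \<in> vfields M" and C: "?C \<in> vfields M" using XY by simp_all
  have gD: "g [?D, Z] = 0" if "Z \<in> vfields M" for Z
  proof -
    have "X = ?D + Y" by simp
    then have "g [X, Z] = g [?D, Z] + g [Y, Z]"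
      using tensor2_add(1)[OF g2 D XY(2) that] by simp
    moreover have "g [X, Z] = g [Y, Z]" using fun_cong[OF eq, of "[Z]"] by (simp add: contract_def)
    ultimately show ?thesis by simp
  qed
  \<comment> \<open>Reality of \<open>g\<close> transfers degeneracy from the difference to its
    conjugate.\<close>
  have gC: "g [?C, Z] = 0" if "Z \<in> vfields M" for Z
  proof -
    have "g [?C, Z] = cnj_fun (g [?D, cnj_vf Z])"
      using fun_cong[OF real, of "[?C, Z]"] by (simp add: cnj_tensor_def)
    then show ?thesis using gD[of "cnj_vf Z"] that by simp
  qed
  have "?U = 0"
    by (rule zero) (use D C in \<open>simp_all add: cnj_vf_add tensor2_add(1)[OF g2] gD gC add.commute\<close>)
  moreover have "?V = 0"
  proof (rule zero)
    have V: "?V = \<i> \<odot>\<^sub>C ?D + (- \<i>) \<odot>\<^sub>C ?C" by (simp add: fun_eq_iff algebra_simps)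
    show "?V \<in> vfields M" using D C by simp
    then show "g [?V, ?V] = 0"
      using D C by (simp only: V tensor2_add(1)[OF g2] tensor2_cmul(1)[OF g2] vf_cmul_mem gD gC mult_zero_right add_0)
    show "cnj_vf ?V = ?V"
      unfolding V by (simp add: cnj_vf_add cnj_vf_cmul add.commute)
  qed
  ultimately have "?D f p + ?C f p = 0" "\<i> * (?D f p - ?C f p) = 0" for f p
    by (simp_all only: fun_eq_iff plus_fun_apply cmul_apply minus_apply zero_fun_apply)
  moreover have "x = 0" if "x + y = 0" "\<i> * (x - y) = 0" for x y :: complex
    using that by auto
  ultimately have "?D f p = 0" for f p by blast
  then show "X = Y" by (simp add: fun_eq_iff)
qed

text \<open>\<open>metric_inv\<close> is a chosen preimage, so injectivity fixes its values on forms
  \<open>contract X g\<close>; the graphs of \<open>g\<close> and \<open>-g\<close> below involve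
  only such forms.\<close>

lemma metric_inv_contract:
  "riemannian_metric M g \<Longrightarrow> X \<in> vfields M \<Longrightarrow> metric_inv M g (contract X g) = X"
  unfolding metric_inv_def by (rule inv_into_f_f[OF metric_injective])

end

section \<open>Hermitian metrics\<close>

lemma contract_cmul: "contract X (c \<odot>\<^sub>C T) = c \<odot>\<^sub>C contract X T"
  by (simp add: contract_def fun_eq_iff)

context smooth_atlas
begin

lemma contract_vf_cmul:
  assumes "T \<in> tensors M 2" "X \<in> vfields M"
  shows "contract (c \<odot>\<^sub>C X) T = c \<odot>\<^sub>C contract X T"
  unfolding cmul_def by (rule contract_vf_smul[OF assms smooth_const])

lemma contract_vf_uminus:
  assumes "T \<in> tensors M 2" "X \<in> vfields M"
  shows "contract (- X) T = - contract X T"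
  unfolding vf_uminus_cmul contract_vf_cmul[OF assms] by (simp add: fun_eq_iff)

lemma contract_vf_diff:
  assumes "T \<in> tensors M 2" "X \<in> vfields M" "Y \<in> vfields M"
  shows "contract (X - Y) T = contract X T - contract Y T"
  using contract_vf_add[OF assms(1,2), of "- Y"] contract_vf_uminus[OF assms(1,3)] assms(3) by simp

end

lemma (in complex_atlas) I_uminus: "X \<in> vfields M \<Longrightarrow> I (- X) = - I X"
  unfolding vf_uminus_cmul[of X] vf_uminus_cmul[of "I X"] by (rule I_cmul)

lemma (in complex_atlas) matchedA_cnj_triple:
  "matchedA M (cnj_triple E) = cnj_sec ` matchedA M E" if "cstr E = I"
  using that by (simp add: matchedA_def cnj_triple_def cnj_matched_dirac)

lemma (in complex_atlas) matchedB_cnj_triple: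
  "matchedB M (cnj_triple E) = cnj_sec ` matchedB M E" if "cstr E = I"
  using that by (simp add: matchedB_def cnj_triple_def cnj_matched_dirac)

locale hermitian_structure = complex_atlas M I
  for M :: "('a::{t2_space,second_countable_topology}, 'e::euclidean_space) atlas" and I +
  fixes g :: "'a tensor"
  assumes metric: "riemannian_metric M g"
    and orthogonal: "X \<in> vfields M \<Longrightarrow> Y \<in> vfields M \<Longrightarrow> g [I X, I Y] = g [X, Y]"
begin

lemma g2: "g \<in> tensors M 2"
  using metric unfolding riemannian_metric_def by blast

lemma g_real: "cnj_tensor g = g"
  using metric unfolding riemannian_metric_def by blast

lemma g_sym: "X \<in> vfields M \<Longrightarrow> Y \<in> vfields M \<Longrightarrow> g [X, Y] = g [Y, X]"
  using metric unfolding riemannian_metric_def by blast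

lemma g_skew:
  assumes "X \<in> vfields M" "Y \<in> vfields M" shows "g [I X, Y] = - g [X, I Y]"
proof -
  have "- g [I X, Y] = g [X, I Y]"
    using orthogonal[of X "I Y"] assms by (simp add: I_I tensor2_uminus(2)[OF g2])
  then show ?thesis by (metis minus_minus)
qed

section \<open>The fundamental form of a Hermitian metric\<close>

abbreviation \<omega> where "\<omega> \<equiv> kaehler_form g I"

lemma kaehler_pair: "\<omega> [X, Y] = g [I X, Y]"
  by (simp add: kaehler_form_def)

lemma kaehler_length: "length Xs \<noteq> 2 \<Longrightarrow> \<omega> Xs = 0"
  by (auto simp: kaehler_form_def split: list.split)

text \<open>For a non-field \<open>X\<close> the first argument of \<open>g\<close> becomes the
  vector field 0, so \<open>tensor2_zero\<close> is needed besides the normalization.\<close>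

lemma kaehler_not_vf: "X \<notin> vfields M \<or> Y \<notin> vfields M \<Longrightarrow> \<omega> [X, Y] = 0"
  unfolding kaehler_pair using tensor2_not_vf[OF g2] tensor2_zero(1)[OF g2] I_not_vf by metis

lemma kaehler_tensor: "\<omega> \<in> tensors M 2"
proof (rule tensorsI)
  show "\<omega> Xs \<in> smooth_funs M" if "length Xs = 2" for Xs
    using that tensor_smooth[OF g2] by (auto simp: kaehler_pair numeral_2_eq_2 length_Suc_conv)
  show "\<omega> Xs = 0" if "\<not> (length Xs = 2 \<and> set Xs \<subseteq> vfields M)" for Xs
  proof (cases "length Xs = 2")
    case True
    then obtain X Y where "Xs = [X, Y]" by (auto simp: numeral_2_eq_2 length_Suc_conv)
    then show ?thesis using that True kaehler_not_vf[of X Y] by auto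
  qed (rule kaehler_length)
next
  fix Xs X Y and i :: nat and f :: "'a cfun"
  assume *: "length Xs = 2" "set Xs \<subseteq> vfields M" "i < 2" "X \<in> vfields M"
  then obtain U V where Xs: "Xs = [U, V]" by (auto simp: numeral_2_eq_2 length_Suc_conv)
  have i: "i = 0 \<or> i = 1" using * by auto
  show "\<omega> (Xs[i := X + Y]) = \<omega> (Xs[i := X]) + \<omega> (Xs[i := Y])" if "Y \<in> vfields M"
    using i * that by (auto simp: Xs kaehler_pair I_add tensor2_add[OF g2])
  show "\<omega> (Xs[i := f \<odot> X]) = f * \<omega> (Xs[i := X])" if "f \<in> smooth_funs M"
    using i * that by (auto simp: Xs kaehler_pair I_smul tensor2_smul[OF g2])
qed

text \<open>Symmetry of \<open>g\<close> and skewness of \<open>I\<close> make each diagonal value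
  equal to its own negative.\<close>

lemma kaehler_form_mem: "\<omega> \<in> forms M 2"
  unfolding forms_def
proof (intro CollectI conjI allI impI kaehler_tensor)
  fix Xs i j assume *: "i < j \<and> j < length Xs \<and> Xs ! i = (Xs ! j :: 'a vfield)"
  show "\<omega> Xs = 0"
  proof (cases "length Xs = 2")
    case True
    with * obtain X where Xs: "Xs = [X, X]"
      by (auto simp: numeral_2_eq_2 length_Suc_conv less_Suc_eq)
    show ?thesis
    proof (cases "X \<in> vfields M")
      case True
      then have "g [I X, X] = - g [I X, X]" using g_skew[of X X] g_sym[of X "I X"] by simp
      then show ?thesis by (auto simp: Xs kaehler_pair fun_eq_iff)
    qed (simp add: Xs kaehler_not_vf)
  qed (rule kaehler_length)
qed

text \<open>Orthogonality of \<open>I\<close> makes \<open>\<omega>\<close> of type (1,1), so that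
  \<open>dc_twist\<close> applies to it.\<close>

sublocale invariant_form M I \<omega>
proof
  show "\<omega> [I X, I Y] = \<omega> [X, Y]" if "X \<in> vfields M" "Y \<in> vfields M" for X Y
    using that orthogonal[of "I X" Y] by (simp add: kaehler_pair)
qed (rule kaehler_form_mem)

lemma kaehler_real: "cnj_tensor \<omega> = \<omega>"
proof
  fix Xs
  show "cnj_tensor \<omega> Xs = \<omega> Xs"
  proof (cases "length Xs = 2")
    case True
    then obtain X Y where Xs: "Xs = [X, Y]" by (auto simp: numeral_2_eq_2 length_Suc_conv)
    show ?thesis
      using fun_cong[OF g_real, of "[I X, Y]"]
      by (simp add: Xs cnj_tensor_def kaehler_pair I_cnj)
  qed (simp add: cnj_tensor_def kaehler_length)
qed

lemma contract_kaehler: "contract X \<omega> = contract (I X) g"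
proof
  fix Zs
  show "contract X \<omega> Zs = contract (I X) g Zs"
  proof (cases "length Zs = 1")
    case True
    then show ?thesis by (auto simp: contract_def kaehler_pair length_Suc_conv)
  next
    case False
    then show ?thesis
      using tensor_eq_zero[OF g2, of "I X # Zs"] by (simp add: contract_def kaehler_length)
  qed
qed

lemma contract_g_mem: "X \<in> vfields M \<Longrightarrow> contract X g \<in> tensors M 1"
  using contract_tensor_mem[of g 1 X] g2 by (simp add: numeral_2_eq_2)

text \<open>Skewness of \<open>I\<close> with respect to \<open>g\<close>. It evaluates the
  \<open>I^*\<close> entries of Gualtieri's matrices on graphs.\<close>

lemma dual_map_contract:
  assumes "X \<in> vfields M" shows "dual_map I (contract X g) = - contract (I X) g"
proof
  fix Zs
  show "dual_map I (contract X g) Zs = (- contract (I X) g) Zs"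
  proof (cases "length Zs = 1")
    case True
    then obtain Z where Zs: "Zs = [Z]" by (auto simp: length_Suc_conv)
    show ?thesis
    proof (cases "Z \<in> vfields M")
      case True
      then show ?thesis using assms g_skew[of X Z] by (simp add: Zs dual_map_def contract_def)
    next
      case False
      then show ?thesis
        using tensor2_zero(2)[OF g2] tensor2_not_vf[OF g2]
        by (simp add: Zs dual_map_def contract_def I_not_vf)
    qed
  next
    case False
    then have "g (Y # Ws) = 0" if "length Ws = length Zs" for Y Ws
      using that by (intro tensor_eq_zero[OF g2]) simp
    then show ?thesis by (simp add: dual_map_def contract_def)
  qed
qed

text \<open>Over (0,1)-fields \<open>\<omega>\<close> acts as \<open>-i g\<close>, so the gauge form
  acts as \<open>-s g\<close> and carries the graph of \<open>s g\<close> to \<open>T01 M I\<close>.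
  Gauge transformations preserve isotropy, hence \<open>matched_dirac_eq\<close> applies to the
  image. The plus structure takes \<open>s = 1\<close>, the minus structure
  \<open>s = -1\<close>.\<close>

lemma matched_gauge:
  assumes L: "L \<subseteq> gsections M" "isotropic L" "\<And>a b. a \<in> L \<Longrightarrow> b \<in> L \<Longrightarrow> a + b \<in> L"
    and T01: "\<And>X. X \<in> T01 M I \<Longrightarrow> (X, s \<odot>\<^sub>C contract X g) \<in> L"
  shows "matched_dirac M I (holo_gtangent M I \<inter> gauge_exp ((- s * \<i>) \<odot>\<^sub>C \<omega>) ` L) =
    gauge_exp ((- s * \<i>) \<odot>\<^sub>C \<omega>) ` L" (is "_ = gauge_exp ?B ` L")
proof (rule matched_dirac_eq)
  have B: "?B \<in> forms M 2" by (rule forms_cmul_mem[OF kaehler_form_mem])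
  show "gauge_exp ?B ` L \<subseteq> gsections M"
    using L(1) gauge_exp_mem[OF B] by blast
  show "isotropic (gauge_exp ?B ` L)"
    using L(2) unfolding isotropic_def by (simp only: ball_simps pairing_gauge_exp[OF B])
  show "a + b \<in> gauge_exp ?B ` L" if ab: "a \<in> gauge_exp ?B ` L" "b \<in> gauge_exp ?B ` L" for a b
  proof -
    from ab obtain a' b' where *: "a' \<in> L" "b' \<in> L" "a = gauge_exp ?B a'" "b = gauge_exp ?B b'"
      by blast
    then have "a + b = gauge_exp ?B (a' + b')"
      using gauge_exp_add[OF B, of a' b'] L(1)[THEN subsetD] by metis
    then show ?thesis using L(3)[OF *(1,2)] by blast
  qed
  show "(X, 0) \<in> gauge_exp ?B ` L" if "X \<in> T01 M I" for X
  proof -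
    have X: "X \<in> vfields M" "I X = (- \<i>) \<odot>\<^sub>C X" using that by (auto simp: T01_def)
    have "contract X ?B = (- s) \<odot>\<^sub>C contract X g"
      unfolding contract_cmul contract_kaehler X(2) contract_vf_cmul[OF g2 X(1)]
      by (simp add: fun_eq_iff mult.assoc)
    then have "(X, 0) = gauge_exp ?B (X, s \<odot>\<^sub>C contract X g)"
      by (simp add: gauge_exp_def fun_eq_iff)
    then show ?thesis using T01[OF that] by blast
  qed
qed

end

section \<open>Gualtieri's endomorphisms on the graphs of g and -g\<close>

locale bihermitian_structure =
  plus: hermitian_structure M Iplus g + minus: hermitian_structure M Iminus g
  for M :: "('a::{t2_space,second_countable_topology}, 'e::euclidean_space) atlas"
    and Iplus Iminus and g :: "'a tensor"
begin

lemma metric_inv_uminus_contract: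
  assumes "X \<in> vfields M" shows "metric_inv M g (- contract X g) = - X"
  using plus.metric_inv_contract[OF plus.metric, of "- X"] assms
  by (simp add: plus.contract_vf_uminus[OF plus.g2])

lemma dual_map_uminus: "dual_map J (- \<alpha>) = - dual_map J \<alpha>"
  by (simp add: dual_map_def fun_eq_iff)

text \<open>On the graph of \<open>g\<close> the field \<open>Z\<close> is \<open>X\<close>, and the
  contributions of \<open>Iminus\<close> cancel in both matrices.\<close>

lemma gualtieri_plus:
  assumes "X \<in> vfields M"
  shows "gualtieri_JA M g Iplus Iminus (X, contract X g) = (Iplus X, contract (Iplus X) g)"
    and "gualtieri_JB M g Iplus Iminus (X, contract X g) = (Iplus X, contract (Iplus X) g)"
  using assms
  by (auto simp: gualtieri_JA_def gualtieri_JB_def plus.metric_inv_contract[OF plus.metric]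
      plus.dual_map_contract minus.dual_map_contract plus.contract_vf_diff[OF plus.g2]
      plus.contract_vf_add[OF plus.g2] gsmul_def fun_eq_iff)

text \<open>Here \<open>Z\<close> is \<open>- X\<close>, and the contributions of
  \<open>Iplus\<close> cancel.\<close>

lemma gualtieri_minus:
  assumes "X \<in> vfields M"
  shows "gualtieri_JA M g Iplus Iminus (X, - contract X g) = (Iminus X, - contract (Iminus X) g)"
    and "gualtieri_JB M g Iplus Iminus (X, - contract X g) = (- Iminus X, contract (Iminus X) g)"
  using assms
  by (auto simp: gualtieri_JA_def gualtieri_JB_def metric_inv_uminus_contract dual_map_uminus
      plus.I_uminus minus.I_uminus
      plus.dual_map_contract minus.dual_map_contract plus.contract_vf_diff[OF plus.g2]
      plus.contract_vf_add[OF plus.g2] gsmul_def fun_eq_iff)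

end

section \<open>Generalized Kaehler structures\<close>

lemma gauge_exp_image: "gauge_exp B ` gauge_exp C ` S = gauge_exp (B + C) ` S"
  by (simp add: image_image gauge_exp_gauge_exp)

lemma cnj_gauge_exp_image: "cnj_sec ` gauge_exp B ` S = gauge_exp (cnj_tensor B) ` cnj_sec ` S"
  by (simp add: image_image cnj_sec_gauge_exp)

lemma cnj_cnj_image: "cnj_sec ` cnj_sec ` S = S"
  by (simp add: image_image)

text \<open>Provides the three premises on \<open>L\<close> in \<open>matched_gauge\<close> for the
  conjugate of an eigenbundle.\<close>

lemma isotropic_submodule_cnj:
  assumes "smooth_atlas M" "gsubmodule M L" "isotropic L"
  shows "cnj_sec ` L \<subseteq> gsections M" and "isotropic (cnj_sec ` L)"
    and "a \<in> cnj_sec ` L \<Longrightarrow> b \<in> cnj_sec ` L \<Longrightarrow> a + b \<in> cnj_sec ` L"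
proof -
  interpret smooth_atlas M by fact
  show "cnj_sec ` L \<subseteq> gsections M"
    using assms(2) cnj_sec_mem unfolding gsubmodule_def by blast
  show "isotropic (cnj_sec ` L)"
    using assms(3) unfolding isotropic_def by (simp only: ball_simps pairing_cnj_sec) (metis cnj_fun_zero)
  show "a + b \<in> cnj_sec ` L" if "a \<in> cnj_sec ` L" "b \<in> cnj_sec ` L"
  proof -
    from that obtain a' b' where "a' \<in> L" "b' \<in> L" "a = cnj_sec a'" "b = cnj_sec b'"
      by blast
    moreover from this have "a' + b' \<in> L" using assms(2) unfolding gsubmodule_def by blast
    ultimately show ?thesis using cnj_sec_add[of a' b'] by (metis imageI)
  qed
qed

section \<open>Eigenbundles, matched pairs and twists of the two Manin triples\<close>

locale generalized_kaehler_structure = bihermitian_structure M Iplus Iminus g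
  for M :: "('a::{t2_space,second_countable_topology}, 'e::euclidean_space) atlas"
    and Iplus Iminus and g :: "'a tensor" +
  fixes H :: "'a tensor" and JA JB :: "'a gsection \<Rightarrow> 'a gsection"
  assumes H_real: "cnj_tensor H = H"
    and data: "generalized_kaehler_data M H JA JB g Iplus Iminus"
begin

abbreviation "LA \<equiv> eigenbundle M JA"
abbreviation "LB \<equiv> eigenbundle M JB"
abbreviation "Ep \<equiv> manin_plus M JA JB g Iplus"
abbreviation "Em \<equiv> manin_minus M JA JB g Iminus"

lemma L_isotropic: "gsubmodule M LA" "isotropic LA" "gsubmodule M LB" "isotropic LB"
  using data unfolding generalized_kaehler_data_def generalized_kaehler_def
    generalized_complex_def maximal_isotropic_def by blast+

lemma L_submodule:
  "LA \<subseteq> gsections M" "a \<in> LA \<Longrightarrow> b \<in> LA \<Longrightarrow> a + b \<in> LA"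
  "LB \<subseteq> gsections M" "a \<in> LB \<Longrightarrow> b \<in> LB \<Longrightarrow> a + b \<in> LB"
  using L_isotropic(1,3) unfolding gsubmodule_def by blast+

lemma J_eq:
  "a \<in> gsections M \<Longrightarrow> JA a = gualtieri_JA M g Iplus Iminus a"
  "a \<in> gsections M \<Longrightarrow> JB a = gualtieri_JB M g Iplus Iminus a"
  using data unfolding generalized_kaehler_data_def by blast+

lemma graph_mem: "X \<in> vfields M \<Longrightarrow> (X, c \<odot>\<^sub>C contract X g) \<in> gsections M"
  using plus.tensor_cmul_mem[OF plus.contract_g_mem] by (simp add: gsections_def)

text \<open>Both endomorphisms act as \<open>Iplus\<close> on the graph of \<open>g\<close>. The
  scalar 1 is kept to fit the parameter \<open>s\<close> of \<open>matched_gauge\<close>.\<close>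

lemma graph_plus:
  assumes "X \<in> T10 M Iplus"
  shows "(X, 1 \<odot>\<^sub>C contract X g) \<in> LA" and "(X, 1 \<odot>\<^sub>C contract X g) \<in> LB"
proof -
  have X: "X \<in> vfields M" "Iplus X = \<i> \<odot>\<^sub>C X" using assms by (auto simp: T10_def)
  have 1: "1 \<odot>\<^sub>C contract X g = contract X g" by (simp add: fun_eq_iff)
  have "gsmul (\<lambda>_. \<i>) (X, contract X g) = (Iplus X, contract (Iplus X) g)"
    by (simp add: X(2) plus.contract_vf_cmul[OF plus.g2 X(1)] gsmul_def fun_eq_iff)
  then show "(X, 1 \<odot>\<^sub>C contract X g) \<in> LA" and "(X, 1 \<odot>\<^sub>C contract X g) \<in> LB"
    using graph_mem[OF X(1), of 1] gualtieri_plus[OF X(1)]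
    by (simp_all add: eigenbundle_def 1 J_eq)
qed

text \<open>On the graph of \<open>-g\<close>, \<open>JB\<close> acts as \<open>- Iminus\<close>, so
  its eigenbundle contains the part over (0,1)-fields. This is why \<open>dirB\<close> of the minus
  triple uses \<open>LB\<close> itself while the other Dirac structures use conjugates.\<close>

lemma graph_minus:
  shows "X \<in> T10 M Iminus \<Longrightarrow> (X, (- 1) \<odot>\<^sub>C contract X g) \<in> LA"
    and "X \<in> T01 M Iminus \<Longrightarrow> (X, (- 1) \<odot>\<^sub>C contract X g) \<in> LB"
proof -
  have 1: "(- 1) \<odot>\<^sub>C contract X g = - contract X g" by (simp add: fun_eq_iff)
  show "(X, (- 1) \<odot>\<^sub>C contract X g) \<in> LA" if "X \<in> T10 M Iminus"
  proof -
    have X: "X \<in> vfields M" "Iminus X = \<i> \<odot>\<^sub>C X" using that by (auto simp: T10_def)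
    have "gsmul (\<lambda>_. \<i>) (X, - contract X g) = (Iminus X, - contract (Iminus X) g)"
      by (simp add: X(2) plus.contract_vf_cmul[OF plus.g2 X(1)] gsmul_def fun_eq_iff)
    then show ?thesis
      using graph_mem[OF X(1), of "- 1"] gualtieri_minus(1)[OF X(1)]
      by (simp add: eigenbundle_def 1 J_eq)
  qed
  show "(X, (- 1) \<odot>\<^sub>C contract X g) \<in> LB" if "X \<in> T01 M Iminus"
  proof -
    have X: "X \<in> vfields M" "Iminus X = (- \<i>) \<odot>\<^sub>C X" using that by (auto simp: T01_def)
    have "gsmul (\<lambda>_. \<i>) (X, - contract X g) = (- Iminus X, contract (Iminus X) g)"
      by (simp add: X(2) plus.contract_vf_cmul[OF plus.g2 X(1)] gsmul_def fun_eq_iff)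
    then show ?thesis
      using graph_mem[OF X(1), of "- 1"] gualtieri_minus(2)[OF X(1)]
      by (simp add: eigenbundle_def 1 J_eq)
  qed
qed

text \<open>As \<open>s\<close> and \<open>g\<close> are real, conjugation maps the graph of
  \<open>s g\<close> to itself.\<close>

lemma cnj_graph:
  assumes "(cnj_vf X, complex_of_real s \<odot>\<^sub>C contract (cnj_vf X) g) \<in> L"
  shows "(X, complex_of_real s \<odot>\<^sub>C contract X g) \<in> cnj_sec ` L"
proof -
  have "(X, complex_of_real s \<odot>\<^sub>C contract X g) =
      cnj_sec (cnj_vf X, complex_of_real s \<odot>\<^sub>C contract (cnj_vf X) g)"
    by (simp add: cnj_sec_def cnj_tensor_cmul cnj_tensor_contract plus.g_real)
  then show ?thesis using assms by blast
qed

lemma matched_plus: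
  "matchedA M Ep = gauge_exp ((- \<i>) \<odot>\<^sub>C plus.\<omega>) ` cnj_sec ` LA"
  "matchedB M Ep = gauge_exp ((- \<i>) \<odot>\<^sub>C plus.\<omega>) ` cnj_sec ` LB"
proof -
  have c: "cnj_vf X \<in> T10 M Iplus" if "X \<in> T01 M Iplus" for X
    using that plus.cnj_T01_iff by blast
  have "(X, 1 \<odot>\<^sub>C contract X g) \<in> cnj_sec ` LA" "(X, 1 \<odot>\<^sub>C contract X g) \<in> cnj_sec ` LB"
    if "X \<in> T01 M Iplus" for X
    using cnj_graph[of X 1] graph_plus[OF c[OF that]] by simp_all
  note this = plus.matched_gauge[OF isotropic_submodule_cnj[OF plus.smooth_atlas_axioms L_isotropic(1,2)] this(1)]
    plus.matched_gauge[OF isotropic_submodule_cnj[OF plus.smooth_atlas_axioms L_isotropic(3,4)] this(2)]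
  then show "matchedA M Ep = gauge_exp ((- \<i>) \<odot>\<^sub>C plus.\<omega>) ` cnj_sec ` LA"
    "matchedB M Ep = gauge_exp ((- \<i>) \<odot>\<^sub>C plus.\<omega>) ` cnj_sec ` LB"
    by (simp_all add: matchedA_def matchedB_def manin_plus_def Let_def)
qed

lemma matched_minus:
  "matchedA M Em = gauge_exp (\<i> \<odot>\<^sub>C minus.\<omega>) ` cnj_sec ` LA"
  "matchedB M Em = gauge_exp (\<i> \<odot>\<^sub>C minus.\<omega>) ` LB"
proof -
  have c: "cnj_vf X \<in> T10 M Iminus" if "X \<in> T01 M Iminus" for X
    using that minus.cnj_T01_iff by blast
  have "(X, (- 1) \<odot>\<^sub>C contract X g) \<in> cnj_sec ` LA" if "X \<in> T01 M Iminus" for X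
    using cnj_graph[of X "- 1"] graph_minus(1)[OF c[OF that]] by simp
  note this = minus.matched_gauge[OF isotropic_submodule_cnj[OF plus.smooth_atlas_axioms L_isotropic(1,2)] this]
    minus.matched_gauge[OF L_submodule(3) L_isotropic(4) L_submodule(4) graph_minus(2)]
  then show "matchedA M Em = gauge_exp (\<i> \<odot>\<^sub>C minus.\<omega>) ` cnj_sec ` LA"
    "matchedB M Em = gauge_exp (\<i> \<odot>\<^sub>C minus.\<omega>) ` LB"
    by (simp_all add: matchedA_def matchedB_def manin_minus_def Let_def)
qed

text \<open>\<open>dc_twist\<close>, with the bihermitian equations inserted for the
  \<open>d^c\<close> terms.\<close>

lemma twist_plus: "twist Ep = H + extd M ((- \<i>) \<odot>\<^sub>C plus.\<omega>)"
  and twist_minus: "twist Em = H + extd M (\<i> \<odot>\<^sub>C minus.\<omega>)"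
proof -
  have "dc_op M Iplus 2 plus.\<omega> = H" "- dc_op M Iminus 2 minus.\<omega> = H"
    using data unfolding generalized_kaehler_data_def bihermitian_def by blast+
  then show "twist Ep = H + extd M ((- \<i>) \<odot>\<^sub>C plus.\<omega>)"
    and "twist Em = H + extd M (\<i> \<odot>\<^sub>C minus.\<omega>)"
    using plus.dc_twist(1) minus.dc_twist(2)
    by (simp_all add: manin_plus_def manin_minus_def Let_def)
qed

text \<open>\<open>H\<close> and both fundamental forms are real, so conjugation only changes the
  sign of \<open>i\<close>.\<close>

lemma twist_cnj:
  "twist (cnj_triple Ep) = H + extd M (\<i> \<odot>\<^sub>C plus.\<omega>)"
  "twist (cnj_triple Em) = H + extd M ((- \<i>) \<odot>\<^sub>C minus.\<omega>)"
  by (simp_all add: cnj_triple_def twist_plus twist_minus cnj_tensor_add H_real plus.cnj_tensor_extd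
      cnj_tensor_cmul plus.kaehler_real minus.kaehler_real)

lemma matched_cnj:
  "matchedA M (cnj_triple Ep) = cnj_sec ` matchedA M Ep"
  "matchedB M (cnj_triple Ep) = cnj_sec ` matchedB M Ep"
  "matchedA M (cnj_triple Em) = cnj_sec ` matchedA M Em"
  "matchedB M (cnj_triple Em) = cnj_sec ` matchedB M Em"
  by (simp_all add: plus.matchedA_cnj_triple plus.matchedB_cnj_triple minus.matchedA_cnj_triple
      minus.matchedB_cnj_triple manin_plus_def manin_minus_def Let_def)

text \<open>All four twists differ from \<open>H\<close> by the derivative of a gauge form, so each
  arrow reduces to adding exponents.\<close>

lemma courant_iso_twists:
  assumes "B \<in> forms M 2" "C \<in> forms M 2" "C' = B + C"
  shows "courant_iso M (H + extd M C) (H + extd M C') (gauge_exp B)"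
  using plus.gauge_courant_iso[OF assms(1), of "H + extd M C"]
    plus.extd_add[OF assms(1,2)[THEN plus.forms_tensors]] assms(3)
  by (simp add: add_ac)

end

section \<open>Assembly of the square of gauge equivalences\<close>

theorem theorem1p7:
  fixes M :: "('a::{t2_space,second_countable_topology}, 'e::euclidean_space) atlas"
    and H g :: "'a tensor"
    and JA JB :: "'a gsection \<Rightarrow> 'a gsection"
    and Iplus Iminus :: "'a vfield \<Rightarrow> 'a vfield"
    and \<omega>p \<omega>m :: "'a tensor"
    and Ep Em :: "'a holo_triple"
  assumes "smooth_manifold M"
    and "H \<in> forms M 3" and "cnj_tensor H = H" and "extd M H = 0"
    and "generalized_kaehler_data M H JA JB g Iplus Iminus"
    and "\<omega>p = kaehler_form g Iplus" and "\<omega>m = kaehler_form g Iminus"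
    and "Ep = manin_plus M JA JB g Iplus" and "Em = manin_minus M JA JB g Iminus"
  shows
    "(courant_iso M (twist Ep) (twist (cnj_triple Em)) (gauge_exp (\<i> \<odot>\<^sub>C (\<omega>p - \<omega>m))) \<and>
        gauge_exp (\<i> \<odot>\<^sub>C (\<omega>p - \<omega>m)) ` matchedB M Ep = matchedB M (cnj_triple Em)) \<and>
     (courant_iso M (twist Em) (twist (cnj_triple Ep)) (gauge_exp (\<i> \<odot>\<^sub>C (\<omega>p - \<omega>m))) \<and>
        gauge_exp (\<i> \<odot>\<^sub>C (\<omega>p - \<omega>m)) ` matchedB M Em = matchedB M (cnj_triple Ep)) \<and>
     (courant_iso M (twist Em) (twist Ep) (gauge_exp ((- \<i>) \<odot>\<^sub>C (\<omega>p + \<omega>m))) \<and>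
        gauge_exp ((- \<i>) \<odot>\<^sub>C (\<omega>p + \<omega>m)) ` matchedA M Em = matchedA M Ep) \<and>
     (courant_iso M (twist (cnj_triple Ep)) (twist (cnj_triple Em)) (gauge_exp ((- \<i>) \<odot>\<^sub>C (\<omega>p + \<omega>m))) \<and>
        gauge_exp ((- \<i>) \<odot>\<^sub>C (\<omega>p + \<omega>m)) ` matchedA M (cnj_triple Ep) = matchedA M (cnj_triple Em)) \<and>
     (\<forall>a\<in>gsections M. gauge_exp (\<i> \<odot>\<^sub>C (\<omega>p - \<omega>m)) (gauge_exp ((- \<i>) \<odot>\<^sub>C (\<omega>p + \<omega>m)) a) =
        gauge_exp ((- \<i>) \<odot>\<^sub>C (\<omega>p + \<omega>m)) (gauge_exp (\<i> \<odot>\<^sub>C (\<omega>p - \<omega>m)) a)) \<and>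
     (matchedA M Ep = gauge_exp ((- \<i>) \<odot>\<^sub>C (\<omega>p + \<omega>m)) ` matchedA M Em) \<and>
     (cnj_sec ` matchedB M Em = gauge_exp (\<i> \<odot>\<^sub>C (\<omega>p - \<omega>m)) ` matchedB M Ep) \<and>
     (cnj_sec ` matchedA M Ep = gauge_exp (\<i> \<odot>\<^sub>C (\<omega>p + \<omega>m)) ` cnj_sec ` matchedA M Em) \<and>
     (matchedB M Em = gauge_exp ((- \<i>) \<odot>\<^sub>C (\<omega>p - \<omega>m)) ` cnj_sec ` matchedB M Ep)"
proof -
  have bi: "bihermitian M H g Iplus Iminus"
    using assms(5) unfolding generalized_kaehler_data_def by blast
  interpret generalized_kaehler_structure M Iplus Iminus g H JA JB
  proof
    show "smooth_manifold M" "cnj_tensor H = H" by fact+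
    show "generalized_kaehler_data M H JA JB g Iplus Iminus" by fact
    show "complex_structure M Iplus" "complex_structure M Iminus" "riemannian_metric M g"
      using bi unfolding bihermitian_def by blast+
    show "g [Iplus X, Iplus Y] = g [X, Y]" "g [Iminus X, Iminus Y] = g [X, Y]"
      if "X \<in> vfields M" "Y \<in> vfields M" for X Y
      using bi that unfolding bihermitian_def by blast+
  qed
  note [simp] = plus.kaehler_form_mem minus.kaehler_form_mem
  \<comment> \<open>In each line the form of an arrow, added to the form at its source, gives the
    form at its target. The same sums settle the twists and the Dirac structures.\<close>
  have sums:
    "\<i> \<odot>\<^sub>C (\<omega>p - \<omega>m) + (- \<i>) \<odot>\<^sub>C \<omega>p = (- \<i>) \<odot>\<^sub>C \<omega>m"
    "\<i> \<odot>\<^sub>C (\<omega>p - \<omega>m) + \<i> \<odot>\<^sub>C \<omega>m = \<i> \<odot>\<^sub>C \<omega>p"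
    "(- \<i>) \<odot>\<^sub>C (\<omega>p - \<omega>m) + \<i> \<odot>\<^sub>C \<omega>p = \<i> \<odot>\<^sub>C \<omega>m"
    "(- \<i>) \<odot>\<^sub>C (\<omega>p + \<omega>m) + \<i> \<odot>\<^sub>C \<omega>m = (- \<i>) \<odot>\<^sub>C \<omega>p"
    "(- \<i>) \<odot>\<^sub>C (\<omega>p + \<omega>m) + \<i> \<odot>\<^sub>C \<omega>p = (- \<i>) \<odot>\<^sub>C \<omega>m"
    "\<i> \<odot>\<^sub>C (\<omega>p + \<omega>m) + (- \<i>) \<odot>\<^sub>C \<omega>m = \<i> \<odot>\<^sub>C \<omega>p"
    by (simp_all add: fun_eq_iff algebra_simps)
  have cnjs: "cnj_tensor (c \<odot>\<^sub>C \<omega>p) = cnj c \<odot>\<^sub>C \<omega>p" "cnj_tensor (c \<odot>\<^sub>C \<omega>m) = cnj c \<odot>\<^sub>C \<omega>m" for c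
    by (simp_all add: cnj_tensor_cmul assms(6,7) plus.kaehler_real minus.kaehler_real)
  have mem: "c \<odot>\<^sub>C (\<omega>p - \<omega>m) \<in> forms M 2" "c \<odot>\<^sub>C (\<omega>p + \<omega>m) \<in> forms M 2"
    "c \<odot>\<^sub>C \<omega>p \<in> forms M 2" "c \<odot>\<^sub>C \<omega>m \<in> forms M 2" for c
    by (simp_all add: assms(6,7))
  note tw = twist_plus[folded assms(6,8)] twist_minus[folded assms(7,9)]
    twist_cnj[folded assms(6-9)]
  note ma = matched_cnj[folded assms(8,9)] matched_plus[folded assms(6,8)] matched_minus[folded assms(7,9)]
  have iso:
    "courant_iso M (twist Ep) (twist (cnj_triple Em)) (gauge_exp (\<i> \<odot>\<^sub>C (\<omega>p - \<omega>m)))"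
    "courant_iso M (twist Em) (twist (cnj_triple Ep)) (gauge_exp (\<i> \<odot>\<^sub>C (\<omega>p - \<omega>m)))"
    "courant_iso M (twist Em) (twist Ep) (gauge_exp ((- \<i>) \<odot>\<^sub>C (\<omega>p + \<omega>m)))"
    "courant_iso M (twist (cnj_triple Ep)) (twist (cnj_triple Em)) (gauge_exp ((- \<i>) \<odot>\<^sub>C (\<omega>p + \<omega>m)))"
    unfolding tw by (rule courant_iso_twists; simp only: mem sums)+
  have comm: "gauge_exp B (gauge_exp C a) = gauge_exp C (gauge_exp B a)" for B C and a :: "'a gsection"
    by (simp add: gauge_exp_gauge_exp add.commute)
  \<comment> \<open>The ends of a horizontal arrow are gauge transforms of the same bundle,
    \<open>LB\<close> or its conjugate; those of a vertical arrow come likewise from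
    \<open>LA\<close> or its conjugate. So only the exponents have to be added, and the square
    commutes because addition does.\<close>
  show ?thesis
    by (intro conjI ballI iso comm)
      (simp_all only: ma cnj_gauge_exp_image cnj_cnj_image gauge_exp_image cnjs sums
        complex_cnj_minus complex_cnj_i minus_minus)
qed

end
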